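(* Let $A=A(\mathbf q,\mathbf a)$ be a quantum complete intersection over a field $\mathbb K$ that admits a bi-Frobenius algebra structure $(A,\phi,t,S)$ with permutation antipode, where $\pi$ is a permutation of $V$ with $S(x_{\mathbf v})=c_{\mathbf v}x_{\pi(\mathbf v)}$, $c_{\mathbf v}\in\mathbb K$, for all $\mathbf v\in V$. Then: (i) $S(x_{\mathbf a-\mathbf 1})=x_{\mathbf a-\mathbf 1}$; $\pi(\mathbf a-\mathbf 1)=\mathbf a-\mathbf 1$; $\pi^2=\mathrm{Id}$; $S$ is a graded map; $S^2=\mathcal N$ and $S^4=\mathrm{Id}$. (ii) $\pi$ induces a compatible permutation in $S_n$, still denoted by $\pi$, such that $$\pi(\mathbf v)=(v_{\pi^{-1}(1)},\dots,v_{\pi^{-1}(n)}),\qquad x_{\pi(\mathbf v)}=x_1^{v_{\pi^{-1}(1)}}\cdots x_n^{v_{\pi^{-1}(n)}},\qquad\forall\ \mathbf v\in V;$$ and such that $S(x_i)=c_ix_{\pi(i)}$ for $1\le i\le n$, where each $c_i\in\mathbb K$, satisfying $$c_ic_{\pi(i)}=h_{\mathbf e_i}\quad(1\le i\le n),\qquad q_\pi\prod_{1\le i\le n}c_i^{a_i-1}=1.$$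
   Context: **Quantum complete intersections.** Let $\mathbb K$ be a field, $n\ge 2$ an integer, $\mathbf a=(a_1,\dots,a_n)$ an integer vector with all $a_i\ge 2$, and $\mathbf q=(q_{ij})$ an $n\times n$ matrix over $\mathbb K$ with $q_{ii}=1$ and $q_{ij}q_{ji}=1$ for all $i,j$. The quantum complete intersection $A=A(\mathbf q,\mathbf a)$ is the $\mathbb K$-algebra $\mathbb K\langle x_1,\dots,x_n\rangle/\langle x_i^{a_i},\ x_jx_i-q_{ij}x_ix_j,\ 1\le i,j\le n\rangle$. Put $V=\{\mathbf v\in\mathbb N_0^n: v_i\le a_i-1,\ 1\le i\le n\}$ and $x_{\mathbf v}=x_1^{v_1}\cdots x_n^{v_n}$. Then $\{x_{\mathbf v}:\mathbf v\in V\}$ is a $\mathbb K$-basis of $A$ (the standard basis); $\{x_{\mathbf v}^*\}$ is the dual basis of $A^*=\mathrm{Hom}_{\mathbb K}(A,\mathbb K)$. The degree of $x_{\mathbf v}$ is $\sum_iv_i$. A linear map $S:A\to A$ is graded if it preserves the degrees of all $x_{\mathbf v}$, $\mathbf v\in V$. Write $\mathbf 1=(1,\dots,1)$ and $\mathbf e_i$ for the $i$-th unit vector. **Structure coefficients and $\mathcal N$.** For $\mathbf u,\mathbf v\in\mathbb Z^n$: $\mathbf q^{\langle\mathbf u|\mathbf v\rangle}=\prod_{1\le i<j\le n}q_{ij}^{u_jv_i}$ and $h_{\mathbf v}=\mathbf q^{\langle\mathbf a-\mathbf 1-\mathbf v|\mathbf v\rangle}/\mathbf q^{\langle\mathbf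 v|\mathbf a-\mathbf 1-\mathbf v\rangle}$; in particular $h_{\mathbf e_i}=\prod_jq_{ij}^{a_j-1}$. The canonical Nakayama automorphism $\mathcal N$ of $A$ (the Nakayama automorphism with respect to the Frobenius form $x_{\mathbf a-\mathbf 1}^*$) is given by $\mathcal N(x_{\mathbf v})=h_{\mathbf v}x_{\mathbf v}$, $\mathbf v\in V$. **Permutations.** $\pi\in S_n$ acts on $\mathbb Z^n$ by $\pi(\mathbf v)=(v_{\pi^{-1}(1)},\dots,v_{\pi^{-1}(n)})$, so $\pi(\mathbf e_i)=\mathbf e_{\pi(i)}$. It is compatible (with $A$) if $a_{\pi(i)}=a_i$ and $q_{\pi(i)\pi(j)}=q_{ji}$ for all $1\le i,j\le n$. Put $q_\pi=\prod_{1\le j<k\le n}(\mathbf q^{\langle\pi(\mathbf e_k)|\pi(\mathbf e_j)\rangle})^{(a_k-1)(a_j-1)}$. **Bi-Frobenius algebras.** Let $A$ be a finite-dimensional algebra which is also a coalgebra $(A,\Delta,\varepsilon)$ over $\mathbb K$, let $t\in A$, $\phi\in A^*$, and let $S:A\to A$ be the linear map $S(a)=\sum\phi(t_1a)t_2$ (Sweedler notation $\Delta(t)=\sum t_1\otimes t_2$). $(A,\phi,t,S)$ is a bi-Frobenius algebra (with antipode $S$) if: (i) $\varepsilon$ is an algebra homomorphism and $\Delta(1_A)=1_A\otimes 1_A$; (ii) $(A,\phi)$ is a Frobenius algebra, i.e. every element of $A^*$ has the form $x\mapsto\phi(bx)$ for some $b\in A$, and $(A,t)$ is a Frobenius coalgebra,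 i.e. $A=\{\sum f(t_1)t_2: f\in A^*\}$; (iii) $S$ is an algebra anti-homomorphism ($S(1)=1$, $S(ab)=S(b)S(a)$) and a coalgebra anti-homomorphism ($\varepsilon\circ S=\varepsilon$, $\Delta(S(a))=\sum S(a_2)\otimes S(a_1)$). **Permutation antipode.** For a bi-Frobenius algebra structure on $A(\mathbf q,\mathbf a)$, $S$ is a permutation antipode if there are a permutation $\pi$ of the set $V$ and $c_{\mathbf v}\in\mathbb K$ ($\mathbf v\in V$) with $S(x_{\mathbf v})=c_{\mathbf v}x_{\pi(\mathbf v)}$ for all $\mathbf v\in V$. *)

theory Defs
  imports
    "HOL-Algebra.Algebra"
    "HOL-Algebra.Algebraic_Closure_Type"
    "HOL-Library.Poly_Mapping"
begin

text \<open>
  The index set \<open>{1, ..., n}\<close> is a finite linearly ordered type \<open>'n\<close>, so \<open>n\<close> is the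
  cardinality of \<open>'n\<close>. Words over \<open>'n\<close> are made into the free monoid, written additively; the type
  \<open>'n list \<Rightarrow>\<^sub>0 'k\<close> with its convolution product is then the free algebra on \<open>'n\<close> over \<open>'k\<close>.
\<close>

instantiation list :: (type) monoid_add
begin

definition zero_list :: "'a list" where "zero_list = []"
definition plus_list :: "'a list \<Rightarrow> 'a list \<Rightarrow> 'a list" where "plus_list = (@)"

instance by standard (simp_all add: zero_list_def plus_list_def)

end

definition free_algebra :: "('n list \<Rightarrow>\<^sub>0 'k::field) ring" where
  "free_algebra = ring_of_type_algebra"

definition letter :: "'n \<Rightarrow> 'n list \<Rightarrow>\<^sub>0 'k::field" where
  "letter i = Poly_Mapping.single [i] 1"

definition scalar :: "'k::field \<Rightarrow> 'n list \<Rightarrow>\<^sub>0 'k" where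
  "scalar c = Poly_Mapping.single [] c"

definition qci_relators ::
  "('n \<Rightarrow> 'n \<Rightarrow> 'k::field) \<Rightarrow> ('n \<Rightarrow> nat) \<Rightarrow> ('n list \<Rightarrow>\<^sub>0 'k) set" where
  "qci_relators q a =
     {letter i ^ a i | i. True} \<union>
     {letter j * letter i - scalar (q i j) * letter i * letter j | i j. True}"

definition qci_ideal ::
  "('n \<Rightarrow> 'n \<Rightarrow> 'k::field) \<Rightarrow> ('n \<Rightarrow> nat) \<Rightarrow> ('n list \<Rightarrow>\<^sub>0 'k) set" where
  "qci_ideal q a = genideal free_algebra (qci_relators q a)"

definition qci_class ::
  "('n \<Rightarrow> 'n \<Rightarrow> 'k::field) \<Rightarrow> ('n \<Rightarrow> nat) \<Rightarrow> ('n list \<Rightarrow>\<^sub>0 'k) \<Rightarrow> ('n list \<Rightarrow>\<^sub>0 'k) set" where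
  "qci_class q a f = qci_ideal q a +>\<^bsub>free_algebra\<^esub> f"

text \<open>
  On the quotient ring, the scalar \<open>c\<close> acts as multiplication by the class of the constant \<open>c\<close>.
\<close>

definition qci ::
  "('n \<Rightarrow> 'n \<Rightarrow> 'k::field) \<Rightarrow> ('n \<Rightarrow> nat) \<Rightarrow> ('k, ('n list \<Rightarrow>\<^sub>0 'k) set) module" where
  "qci q a = (let Q = free_algebra Quot qci_ideal q a in
     \<lparr>carrier = carrier Q, monoid.mult = monoid.mult Q, one = one Q,
      ring.zero = ring.zero Q, add = add Q,
      module.smult = (\<lambda>c x. qci_class q a (scalar c) \<otimes>\<^bsub>Q\<^esub> x)\<rparr>)"

definition qci_gen ::
  "('n \<Rightarrow> 'n \<Rightarrow> 'k::field) \<Rightarrow> ('n \<Rightarrow> nat) \<Rightarrow> 'n \<Rightarrow> ('n list \<Rightarrow>\<^sub>0 'k) set" where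
  "qci_gen q a i = qci_class q a (letter i)"

definition qci_params :: "('n::finite \<Rightarrow> 'n \<Rightarrow> 'k::field) \<Rightarrow> ('n \<Rightarrow> nat) \<Rightarrow> bool" where
  "qci_params q a \<longleftrightarrow>
     card (UNIV :: 'n set) \<ge> 2 \<and> (\<forall>i. a i \<ge> 2) \<and> (\<forall>i. q i i = 1) \<and> (\<forall>i j. q i j * q j i = 1)"

definition basis_index :: "('n \<Rightarrow> nat) \<Rightarrow> ('n \<Rightarrow> nat) set" where
  "basis_index a = {v. \<forall>i. v i \<le> a i - 1}"

definition top_index :: "('n \<Rightarrow> nat) \<Rightarrow> 'n \<Rightarrow> nat" where
  "top_index a = (\<lambda>i. a i - 1)"

definition unit_index :: "'n \<Rightarrow> 'n \<Rightarrow> 'z::zero_neq_one" where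
  "unit_index i = (\<lambda>j. if j = i then 1 else 0)"

definition qci_monomial ::
  "('n::{finite,linorder} \<Rightarrow> 'n \<Rightarrow> 'k::field) \<Rightarrow> ('n \<Rightarrow> nat) \<Rightarrow> ('n \<Rightarrow> nat) \<Rightarrow>
     ('n list \<Rightarrow>\<^sub>0 'k) set" where
  "qci_monomial q a v =
     foldr (\<lambda>i y. (qci_gen q a i [^]\<^bsub>qci q a\<^esub> v i) \<otimes>\<^bsub>qci q a\<^esub> y)
       (sorted_list_of_set UNIV) \<one>\<^bsub>qci q a\<^esub>"

definition qpair ::
  "('n::{finite,linorder} \<Rightarrow> 'n \<Rightarrow> 'k::field) \<Rightarrow> ('n \<Rightarrow> int) \<Rightarrow> ('n \<Rightarrow> int) \<Rightarrow> 'k" where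
  "qpair q u v = (\<Prod>(i, j)\<in>{(i, j). i < j}. q i j powi (u j * v i))"

definition hcoef ::
  "('n::{finite,linorder} \<Rightarrow> 'n \<Rightarrow> 'k::field) \<Rightarrow> ('n \<Rightarrow> nat) \<Rightarrow> ('n \<Rightarrow> int) \<Rightarrow> 'k" where
  "hcoef q a v =
     qpair q (\<lambda>i. int (a i) - 1 - v i) v / qpair q v (\<lambda>i. int (a i) - 1 - v i)"

definition perm_act :: "('n \<Rightarrow> 'n) \<Rightarrow> ('n \<Rightarrow> 'z) \<Rightarrow> 'n \<Rightarrow> 'z" where
  "perm_act \<sigma> v = (\<lambda>i. v (inv_into UNIV \<sigma> i))"

definition compatible_perm ::
  "('n \<Rightarrow> 'n \<Rightarrow> 'k::field) \<Rightarrow> ('n \<Rightarrow> nat) \<Rightarrow> ('n \<Rightarrow> 'n) \<Rightarrow> bool" where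
  "compatible_perm q a \<sigma> \<longleftrightarrow>
     bij \<sigma> \<and> (\<forall>i. a (\<sigma> i) = a i) \<and> (\<forall>i j. q (\<sigma> i) (\<sigma> j) = q j i)"

definition qperm ::
  "('n::{finite,linorder} \<Rightarrow> 'n \<Rightarrow> 'k::field) \<Rightarrow> ('n \<Rightarrow> nat) \<Rightarrow> ('n \<Rightarrow> 'n) \<Rightarrow> 'k" where
  "qperm q a \<sigma> =
     (\<Prod>(j, k)\<in>{(j, k). j < k}.
        qpair q (perm_act \<sigma> (unit_index k)) (perm_act \<sigma> (unit_index j)) ^ ((a k - 1) * (a j - 1)))"

definition fd_algebra :: "('k::field, 'a) module \<Rightarrow> bool" where
  "fd_algebra A \<longleftrightarrow>
     ring A \<and> module (ring_of_type_algebra :: 'k ring) A \<and>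
     (\<forall>c. \<forall>x\<in>carrier A. \<forall>y\<in>carrier A.
        (c \<odot>\<^bsub>A\<^esub> x) \<otimes>\<^bsub>A\<^esub> y = c \<odot>\<^bsub>A\<^esub> (x \<otimes>\<^bsub>A\<^esub> y) \<and>
        x \<otimes>\<^bsub>A\<^esub> (c \<odot>\<^bsub>A\<^esub> y) = c \<odot>\<^bsub>A\<^esub> (x \<otimes>\<^bsub>A\<^esub> y)) \<and>
     (\<exists>B. finite B \<and> B \<subseteq> carrier A \<and>
        (\<forall>x\<in>carrier A. \<exists>c. x = (\<Oplus>\<^bsub>A\<^esub>b\<in>B. c b \<odot>\<^bsub>A\<^esub> b)))"

definition linear_form :: "('k::field, 'a) module \<Rightarrow> ('a \<Rightarrow> 'k) \<Rightarrow> bool" where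
  "linear_form A f \<longleftrightarrow>
     (\<forall>x\<in>carrier A. \<forall>y\<in>carrier A. f (x \<oplus>\<^bsub>A\<^esub> y) = f x + f y) \<and>
     (\<forall>c. \<forall>x\<in>carrier A. f (c \<odot>\<^bsub>A\<^esub> x) = c * f x)"

definition linear_endo :: "('k::field, 'a) module \<Rightarrow> ('a \<Rightarrow> 'a) \<Rightarrow> bool" where
  "linear_endo A T \<longleftrightarrow>
     T \<in> carrier A \<rightarrow> carrier A \<and>
     (\<forall>x\<in>carrier A. \<forall>y\<in>carrier A. T (x \<oplus>\<^bsub>A\<^esub> y) = T x \<oplus>\<^bsub>A\<^esub> T y) \<and>
     (\<forall>c. \<forall>x\<in>carrier A. T (c \<odot>\<^bsub>A\<^esub> x) = c \<odot>\<^bsub>A\<^esub> T x)"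

text \<open>
  A tensor is represented by a list \<open>[(x\<^sub>1, y\<^sub>1), ..., (x\<^sub>m, y\<^sub>m)]\<close>, standing for the sum of the
  \<open>x\<^sub>i \<otimes> y\<^sub>i\<close>; lists of triples represent elements of the threefold tensor power. Two lists
  represent the same tensor iff all multilinear forms agree on them: multilinear forms are the
  linear forms on the tensor power, and over a field these separate points. A comultiplication is
  given by a choice of representatives \<open>\<Delta> x\<close>, i.e. of Sweedler sums; every notion below is
  invariant under replacing \<open>\<Delta> x\<close> by another representative of the same tensor.
\<close>

definition bilinear_form :: "('k::field, 'a) module \<Rightarrow> ('a \<Rightarrow> 'a \<Rightarrow> 'k) \<Rightarrow> bool" where
  "bilinear_form A \<beta> \<longleftrightarrow>
     (\<forall>x\<in>carrier A. linear_form A (\<lambda>y. \<beta> x y)) \<and>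
     (\<forall>y\<in>carrier A. linear_form A (\<lambda>x. \<beta> x y))"

definition trilinear_form :: "('k::field, 'a) module \<Rightarrow> ('a \<Rightarrow> 'a \<Rightarrow> 'a \<Rightarrow> 'k) \<Rightarrow> bool" where
  "trilinear_form A \<gamma> \<longleftrightarrow>
     (\<forall>x\<in>carrier A. \<forall>y\<in>carrier A. linear_form A (\<lambda>z. \<gamma> x y z)) \<and>
     (\<forall>x\<in>carrier A. \<forall>z\<in>carrier A. linear_form A (\<lambda>y. \<gamma> x y z)) \<and>
     (\<forall>y\<in>carrier A. \<forall>z\<in>carrier A. linear_form A (\<lambda>x. \<gamma> x y z))"

definition tensor2_eq ::
  "('k::field, 'a) module \<Rightarrow> ('a \<times> 'a) list \<Rightarrow> ('a \<times> 'a) list \<Rightarrow> bool" where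
  "tensor2_eq A s t \<longleftrightarrow>
     (\<forall>\<beta>. bilinear_form A \<beta> \<longrightarrow> (\<Sum>(x, y)\<leftarrow>s. \<beta> x y) = (\<Sum>(x, y)\<leftarrow>t. \<beta> x y))"

definition tensor3_eq ::
  "('k::field, 'a) module \<Rightarrow> ('a \<times> 'a \<times> 'a) list \<Rightarrow> ('a \<times> 'a \<times> 'a) list \<Rightarrow> bool" where
  "tensor3_eq A s t \<longleftrightarrow>
     (\<forall>\<gamma>. trilinear_form A \<gamma> \<longrightarrow> (\<Sum>(x, y, z)\<leftarrow>s. \<gamma> x y z) = (\<Sum>(x, y, z)\<leftarrow>t. \<gamma> x y z))"

definition sweedler_sum ::
  "('k::field, 'a) module \<Rightarrow> ('a \<Rightarrow> 'a \<Rightarrow> 'a) \<Rightarrow> ('a \<times> 'a) list \<Rightarrow> 'a" where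
  "sweedler_sum A F s = foldr (\<lambda>(x, y) z. F x y \<oplus>\<^bsub>A\<^esub> z) s \<zero>\<^bsub>A\<^esub>"

definition coalgebra ::
  "('k::field, 'a) module \<Rightarrow> ('a \<Rightarrow> ('a \<times> 'a) list) \<Rightarrow> ('a \<Rightarrow> 'k) \<Rightarrow> bool" where
  "coalgebra A \<Delta> \<epsilon> \<longleftrightarrow>
     linear_form A \<epsilon> \<and>
     (\<forall>x\<in>carrier A. set (\<Delta> x) \<subseteq> carrier A \<times> carrier A) \<and>
     (\<forall>x\<in>carrier A. \<forall>y\<in>carrier A. tensor2_eq A (\<Delta> (x \<oplus>\<^bsub>A\<^esub> y)) (\<Delta> x @ \<Delta> y)) \<and>
     (\<forall>c. \<forall>x\<in>carrier A.
        tensor2_eq A (\<Delta> (c \<odot>\<^bsub>A\<^esub> x)) (map (\<lambda>(x1, x2). (c \<odot>\<^bsub>A\<^esub> x1, x2)) (\<Delta> x))) \<and>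
     (\<forall>x\<in>carrier A.
        tensor3_eq A
          (concat (map (\<lambda>(x1, x2). map (\<lambda>(x11, x12). (x11, x12, x2)) (\<Delta> x1)) (\<Delta> x)))
          (concat (map (\<lambda>(x1, x2). map (\<lambda>(x21, x22). (x1, x21, x22)) (\<Delta> x2)) (\<Delta> x)))) \<and>
     (\<forall>x\<in>carrier A. sweedler_sum A (\<lambda>x1 x2. \<epsilon> x1 \<odot>\<^bsub>A\<^esub> x2) (\<Delta> x) = x) \<and>
     (\<forall>x\<in>carrier A. sweedler_sum A (\<lambda>x1 x2. \<epsilon> x2 \<odot>\<^bsub>A\<^esub> x1) (\<Delta> x) = x)"

definition frobenius_form :: "('k::field, 'a) module \<Rightarrow> ('a \<Rightarrow> 'k) \<Rightarrow> bool" where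
  "frobenius_form A \<phi> \<longleftrightarrow>
     linear_form A \<phi> \<and>
     (\<forall>f. linear_form A f \<longrightarrow> (\<exists>b\<in>carrier A. \<forall>x\<in>carrier A. f x = \<phi> (b \<otimes>\<^bsub>A\<^esub> x)))"

definition frobenius_coform ::
  "('k::field, 'a) module \<Rightarrow> ('a \<Rightarrow> ('a \<times> 'a) list) \<Rightarrow> 'a \<Rightarrow> bool" where
  "frobenius_coform A \<Delta> t \<longleftrightarrow>
     t \<in> carrier A \<and>
     (\<forall>x\<in>carrier A. \<exists>f. linear_form A f \<and>
        x = sweedler_sum A (\<lambda>t1 t2. f t1 \<odot>\<^bsub>A\<^esub> t2) (\<Delta> t))"

definition bi_frobenius ::
  "('k::field, 'a) module \<Rightarrow> ('a \<Rightarrow> ('a \<times> 'a) list) \<Rightarrow> ('a \<Rightarrow> 'k) \<Rightarrow>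
     ('a \<Rightarrow> 'k) \<Rightarrow> 'a \<Rightarrow> ('a \<Rightarrow> 'a) \<Rightarrow> bool" where
  "bi_frobenius A \<Delta> \<epsilon> \<phi> t S \<longleftrightarrow>
     fd_algebra A \<and> coalgebra A \<Delta> \<epsilon> \<and>
     (\<forall>x\<in>carrier A.
        S x = sweedler_sum A (\<lambda>t1 t2. \<phi> (t1 \<otimes>\<^bsub>A\<^esub> x) \<odot>\<^bsub>A\<^esub> t2) (\<Delta> t)) \<and>
     \<epsilon> \<one>\<^bsub>A\<^esub> = 1 \<and> (\<forall>x\<in>carrier A. \<forall>y\<in>carrier A. \<epsilon> (x \<otimes>\<^bsub>A\<^esub> y) = \<epsilon> x * \<epsilon> y) \<and>
     tensor2_eq A (\<Delta> \<one>\<^bsub>A\<^esub>) [(\<one>\<^bsub>A\<^esub>, \<one>\<^bsub>A\<^esub>)] \<and>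
     frobenius_form A \<phi> \<and> frobenius_coform A \<Delta> t \<and>
     S \<one>\<^bsub>A\<^esub> = \<one>\<^bsub>A\<^esub> \<and> (\<forall>x\<in>carrier A. \<forall>y\<in>carrier A. S (x \<otimes>\<^bsub>A\<^esub> y) = S y \<otimes>\<^bsub>A\<^esub> S x) \<and>
     (\<forall>x\<in>carrier A. \<epsilon> (S x) = \<epsilon> x) \<and>
     (\<forall>x\<in>carrier A. tensor2_eq A (\<Delta> (S x)) (map (\<lambda>(x1, x2). (S x2, S x1)) (\<Delta> x)))"

text \<open>
  \<open>permutes\<close> makes \<open>\<pi>\<close> the identity outside \<open>basis_index a\<close>, where its values are irrelevant.
\<close>

definition permutation_antipode ::
  "('n::{finite,linorder} \<Rightarrow> 'n \<Rightarrow> 'k::field) \<Rightarrow> ('n \<Rightarrow> nat) \<Rightarrow>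
     (('n list \<Rightarrow>\<^sub>0 'k) set \<Rightarrow> ('n list \<Rightarrow>\<^sub>0 'k) set) \<Rightarrow>
     (('n \<Rightarrow> nat) \<Rightarrow> 'n \<Rightarrow> nat) \<Rightarrow> (('n \<Rightarrow> nat) \<Rightarrow> 'k) \<Rightarrow> bool" where
  "permutation_antipode q a S \<pi> c \<longleftrightarrow>
     \<pi> permutes basis_index a \<and>
     (\<forall>v\<in>basis_index a. S (qci_monomial q a v) = c v \<odot>\<^bsub>qci q a\<^esub> qci_monomial q a (\<pi> v))"

definition graded_map ::
  "('n::{finite,linorder} \<Rightarrow> 'n \<Rightarrow> 'k::field) \<Rightarrow> ('n \<Rightarrow> nat) \<Rightarrow>
     (('n list \<Rightarrow>\<^sub>0 'k) set \<Rightarrow> ('n list \<Rightarrow>\<^sub>0 'k) set) \<Rightarrow> bool" where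
  "graded_map q a T \<longleftrightarrow>
     linear_endo (qci q a) T \<and>
     (\<forall>v\<in>basis_index a. \<exists>c. T (qci_monomial q a v) =
        (\<Oplus>\<^bsub>qci q a\<^esub>u\<in>{u\<in>basis_index a. (\<Sum>i\<in>UNIV. u i) = (\<Sum>i\<in>UNIV. v i)}.
           c u \<odot>\<^bsub>qci q a\<^esub> qci_monomial q a u))"

definition nakayama_automorphism ::
  "('k::field, 'a) module \<Rightarrow> ('a \<Rightarrow> 'k) \<Rightarrow> ('a \<Rightarrow> 'a) \<Rightarrow> bool" where
  "nakayama_automorphism A \<phi> N \<longleftrightarrow>
     linear_endo A N \<and> N \<in> ring_iso A A \<and>
     (\<forall>x\<in>carrier A. \<forall>y\<in>carrier A. \<phi> (x \<otimes>\<^bsub>A\<^esub> y) = \<phi> (N y \<otimes>\<^bsub>A\<^esub> x))"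

definition dual_basis_form ::
  "('n::{finite,linorder} \<Rightarrow> 'n \<Rightarrow> 'k::field) \<Rightarrow> ('n \<Rightarrow> nat) \<Rightarrow> ('n \<Rightarrow> nat) \<Rightarrow>
     (('n list \<Rightarrow>\<^sub>0 'k) set \<Rightarrow> 'k) \<Rightarrow> bool" where
  "dual_basis_form q a v f \<longleftrightarrow>
     linear_form (qci q a) f \<and>
     (\<forall>u\<in>basis_index a. f (qci_monomial q a u) = (if u = v then 1 else 0))"

text \<open>
  \<open>N\<close> is the Nakayama automorphism with respect to the dual basis vector of the top monomial.
  The explicit formula already follows from the Nakayama identity in the convention above; it is
  included since it is the description of \<open>N\<close> used in computations.
\<close>

definition canonical_nakayama ::
  "('n::{finite,linorder} \<Rightarrow> 'n \<Rightarrow> 'k::field) \<Rightarrow> ('n \<Rightarrow> nat) \<Rightarrow>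
     (('n list \<Rightarrow>\<^sub>0 'k) set \<Rightarrow> ('n list \<Rightarrow>\<^sub>0 'k) set) \<Rightarrow> bool" where
  "canonical_nakayama q a N \<longleftrightarrow>
     (\<exists>\<phi>. dual_basis_form q a (top_index a) \<phi> \<and> nakayama_automorphism (qci q a) \<phi> N) \<and>
     (\<forall>v\<in>basis_index a.
        N (qci_monomial q a v) = hcoef q a (\<lambda>i. int (v i)) \<odot>\<^bsub>qci q a\<^esub> qci_monomial q a v)"

end

theory Submission
  imports Defs "HOL-Library.Function_Algebras" "HOL-Library.Multiset"
begin

text \<open>
  Write \<open>x\<^sub>v\<close> for the standard monomials, \<open>a - 1\<close> for the top exponent, and
  \<open>q\<^bsup>\<langle>u|v\<rangle>\<^esup>\<close> for the scalar with \<open>x\<^sub>u x\<^sub>v = q\<^bsup>\<langle>u|v\<rangle>\<^esup> x\<^bsub>u+v\<^esub>\<close>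
  (\<open>reorder\<close> below). Two features of the algebra drive the
  proof: it is local, with augmentation the coordinate at \<open>x\<^sub>0 = 1\<close>, and its socle is spanned by the
  top monomial, since a nonzero element can be multiplied by a monomial to give a nonzero multiple
  of \<open>x\<^bsub>a-1\<^esub>\<close> (\<open>linear_form_socle_shift\<close>).

  Integral. Every \<open>x\<^sub>v\<close> with \<open>v \<noteq> 0\<close> is nilpotent, so \<open>\<epsilon>\<close> is the augmentation. Applying
  \<open>\<epsilon>\<close> to \<open>S x = \<Sum> \<phi>(t\<^sub>1 x) t\<^sub>2\<close> gives \<open>\<phi>(t x) = \<epsilon> x\<close>, and this places \<open>t\<close> in
  the socle (\<open>t_eq\<close>). The counit then yields \<open>S t = t\<close>, so \<open>S\<close> fixes the top monomial. As every
  \<open>x\<^sub>v\<close> divides the top monomial, \<open>S\<close> kills no \<open>x\<^sub>v\<close>; permuting them up to scalars, it is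
  injective.

  The square of \<open>S\<close>. Since \<open>S t = t\<close> and \<open>S\<close> reverses \<open>\<Delta>\<close>, the tensor \<open>\<Delta> t\<close> may be replaced by
  \<open>\<Sum> S t\<^sub>2 \<otimes> S t\<^sub>1\<close>. In \<open>S x = \<Sum> \<phi>(t\<^sub>1 x) t\<^sub>2\<close> this gives \<open>x = \<Sum> \<phi>(S t\<^sub>2 x) t\<^sub>1\<close> after
  cancelling \<open>S\<close>, and hence \<open>\<phi>(x z) = \<phi>(S(S z) x)\<close> (\<open>phi_nakayama\<close>): \<open>S\<^sup>2\<close> is the Nakayama
  automorphism for \<open>\<phi>\<close>. The dual form of the top monomial is \<open>\<phi>(b \<cdot>)\<close> for some \<open>b\<close> with nonzero constant term,
  so \<open>S\<^sup>2(x\<^sub>v) b = h\<^sub>v b x\<^sub>v\<close>. As \<open>S\<^sup>2(x\<^sub>v)\<close> is a multiple of a single monomial,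
  comparing lowest terms gives \<open>\<pi>\<^sup>2 v = v\<close> and \<open>S\<^sup>2(x\<^sub>v) = h\<^sub>v x\<^sub>v\<close>.

  The permutation. Antimultiplicativity gives, whenever \<open>u + v\<close> is the exponent of a nonzero monomial,
  \<open>\<pi>(u+v) = \<pi> u + \<pi> v\<close> and
  \<open>c\<^bsub>u+v\<^esub> q\<^bsup>\<langle>u|v\<rangle>\<^esup> = c\<^sub>u c\<^sub>v q\<^bsup>\<langle>\<pi> v|\<pi> u\<rangle>\<^esup>\<close> (\<open>pi_add\<close>, \<open>c_add\<close>). Thus \<open>\<pi>\<close>
  cannot lower the degree; being an involution it preserves it, so it permutes the unit vectors and
  is a permutation of coordinates. The remaining identities are instances of the relation for \<open>c\<close>:
  the two orders of \<open>e\<^sub>i + e\<^sub>j\<close> give compatibility, the two orders of a decomposition of \<open>a - 1\<close>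
  give \<open>h\<^sub>v h\<^bsub>\<pi> v\<^esub> = 1\<close>, which with \<open>h\<^bsub>\<pi> v\<^esub> = h\<^sub>v\<close> makes \<open>S\<^sup>4\<close> the identity, and splitting \<open>a - 1\<close>
  into multiples of unit vectors gives the product formula.

  All of this compares coefficients in the standard basis, whose linear independence is proved by
  writing the coordinate functionals down on words and checking that their common kernel is an ideal.
\<close>

section \<open>Linear functionals on a free algebra\<close>

text \<open>
  The linear form on finitely supported functions that takes the value \<open>g w\<close> on the basis vector
  \<open>w\<close>.
\<close>

definition lin_ext :: "('w \<Rightarrow> 'k::field) \<Rightarrow> ('w \<Rightarrow>\<^sub>0 'k) \<Rightarrow> 'k" where
  "lin_ext g p = (\<Sum>w\<in>Poly_Mapping.keys p. Poly_Mapping.lookup p w * g w)"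

lemma lin_ext_superset:
  assumes "finite T" "Poly_Mapping.keys p \<subseteq> T"
  shows "lin_ext g p = (\<Sum>w\<in>T. Poly_Mapping.lookup p w * g w)"
  unfolding lin_ext_def using assms
  by (intro sum.mono_neutral_left) (auto simp: in_keys_iff)

lemma lin_ext_add: "lin_ext g (p + r) = lin_ext g p + lin_ext g r"
proof -
  let ?T = "Poly_Mapping.keys p \<union> Poly_Mapping.keys r"
  have "Poly_Mapping.keys (p + r) \<subseteq> ?T"
    by (rule keys_add)
  then show ?thesis
    by (simp add: lin_ext_superset[of ?T] lookup_add distrib_right sum.distrib)
qed

lemma lin_ext_zero [simp]: "lin_ext g 0 = 0"
  by (simp add: lin_ext_def)

lemma lin_ext_uminus: "lin_ext g (- p) = - lin_ext g p"
  using lin_ext_add[of g p "- p"] by (simp add: eq_neg_iff_add_eq_0 add.commute)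

lemma lin_ext_diff: "lin_ext g (p - r) = lin_ext g p - lin_ext g r"
  using lin_ext_add[of g p "- r"] by (simp add: lin_ext_uminus)

lemma lin_ext_single [simp]: "lin_ext g (Poly_Mapping.single w c) = c * g w"
  by (simp add: lin_ext_def)

lemma lin_ext_scaled: "lin_ext (\<lambda>w. c * g w) p = c * lin_ext g p"
  by (simp add: lin_ext_def sum_distrib_left algebra_simps)

lemma poly_mapping_eq_sum_single:
  "p = (\<Sum>w\<in>Poly_Mapping.keys p. Poly_Mapping.single w (Poly_Mapping.lookup p w))"
  by (intro poly_mapping_eqI)
     (auto simp: lookup_sum lookup_single when_def in_keys_iff)

text \<open>
  Additive statements about elements of the free algebra reduce to multiples of single words.
\<close>

lemma poly_mapping_additive_induct [case_names zero single add]: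
  fixes p :: "'w \<Rightarrow>\<^sub>0 'b::comm_monoid_add"
  assumes "P 0" "\<And>w c. P (Poly_Mapping.single w c)" "\<And>p r. P p \<Longrightarrow> P r \<Longrightarrow> P (p + r)"
  shows "P p"
proof -
  have "P (\<Sum>w\<in>T. Poly_Mapping.single w (Poly_Mapping.lookup p w))" if "finite T" for T
    using that by induction (auto intro: assms)
  from this[OF finite_keys] show ?thesis
    using poly_mapping_eq_sum_single[of p] by metis
qed

lemma lin_ext_single_times:
  fixes p :: "'n list \<Rightarrow>\<^sub>0 'k::field"
  shows "lin_ext g (Poly_Mapping.single w c * p) = c * lin_ext (\<lambda>u. g (w @ u)) p"
  by (induction p rule: poly_mapping_additive_induct)
     (simp_all add: lin_ext_add distrib_left mult_single plus_list_def)

lemma lin_ext_times_single: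
  fixes p :: "'n list \<Rightarrow>\<^sub>0 'k::field"
  shows "lin_ext g (p * Poly_Mapping.single w c) = c * lin_ext (\<lambda>u. g (u @ w)) p"
  by (induction p rule: poly_mapping_additive_induct)
     (simp_all add: lin_ext_add distrib_right distrib_left mult_single plus_list_def)

lemma single_Nil: "Poly_Mapping.single [] 1 = (1 :: 'n list \<Rightarrow>\<^sub>0 'k::field)"
  by (metis single_one zero_list_def)

lemma scalar_times_single [simp]:
  "scalar c * Poly_Mapping.single w d = Poly_Mapping.single w (c * d)"
  by (simp add: scalar_def mult_single plus_list_def)

lemma single_times_scalar [simp]:
  "Poly_Mapping.single w d * scalar c = Poly_Mapping.single w (d * c)"
  by (simp add: scalar_def mult_single plus_list_def)

lemma scalar_central: "scalar c * p = p * scalar c" for p :: "'n list \<Rightarrow>\<^sub>0 'k::field"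
  by (induction p rule: poly_mapping_additive_induct)
     (simp_all add: distrib_left distrib_right mult.commute)

lemma lin_ext_scalar_times: "lin_ext g (scalar c * p) = c * lin_ext g p"
  by (simp add: scalar_def lin_ext_single_times)

lemma letter_power: "letter i ^ k = Poly_Mapping.single (replicate k i) (1::'k::field)"
  by (induction k)
     (simp_all add: letter_def mult_single plus_list_def zero_list_def flip: single_one)

lemma ring_free_algebra: "ring (free_algebra :: ('n list \<Rightarrow>\<^sub>0 'k::field) ring)"
proof -
  have "\<exists>y. x + y = 0" for x :: "'n list \<Rightarrow>\<^sub>0 'k"
    using add.right_inverse by blast
  then show ?thesis
    unfolding free_algebra_def ring_of_type_algebra_def using add.right_inverse
    by unfold_locales (auto simp: algebra_simps Units_def)
qed

section \<open>Reordering coefficients\<close>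

text \<open>
  The scalar produced by sorting the product of the monomials with exponents \<open>u\<close> and \<open>v\<close>; it is
  \<^const>\<open>qpair\<close> on natural exponents, and a bicharacter by the two addition rules below.
\<close>

definition reorder :: "('n::{finite,linorder} \<Rightarrow> 'n \<Rightarrow> 'k::field) \<Rightarrow> ('n \<Rightarrow> nat) \<Rightarrow> ('n \<Rightarrow> nat) \<Rightarrow> 'k" where
  "reorder q u v = (\<Prod>(i, j)\<in>{(i, j). i < j}. q i j ^ (u j * v i))"

lemma qpair_of_nat: "qpair q (\<lambda>i. int (u i)) (\<lambda>i. int (v i)) = reorder q u v"
  by (simp add: qpair_def reorder_def power_int_of_nat flip: of_nat_mult)

lemma reorder_add_left: "reorder q (u + u') v = reorder q u v * reorder q u' v"
  by (simp add: reorder_def flip: prod.distrib)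
     (simp add: algebra_simps power_add case_prod_unfold)

lemma reorder_add_right: "reorder q u (v + v') = reorder q u v * reorder q u v'"
  by (simp add: reorder_def flip: prod.distrib)
     (simp add: algebra_simps power_add case_prod_unfold)

lemma reorder_zero_left [simp]: "reorder q 0 v = 1"
  by (simp add: reorder_def)

lemma reorder_zero_right [simp]: "reorder q u 0 = 1"
  by (simp add: reorder_def)

lemma reorder_eq_1:
  assumes "\<And>i j. i < j \<Longrightarrow> u j = 0 \<or> v i = 0"
  shows "reorder q u v = 1"
  unfolding reorder_def using assms by (intro prod.neutral) fastforce

lemma reorder_unit_unit: "reorder q (unit_index i) (unit_index j) = (if j < i then q j i else 1)"
proof (cases "j < i")
  case True
  have "reorder q (unit_index i) (unit_index j) =
      (\<Prod>p\<in>{(i, j). i < j}. if p = (j, i) then q j i else 1)"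
    unfolding reorder_def by (intro prod.cong) (auto simp: unit_index_def split: if_splits)
  also have "\<dots> = q j i"
    using True by (subst prod.delta) auto
  finally show ?thesis using True by simp
next
  case False
  then show ?thesis
    by (auto intro!: reorder_eq_1 simp: unit_index_def split: if_splits)
qed

text \<open>
  Subtraction of exponents is truncated, so \<open>u \<le> v\<close> has to accompany \<open>v - u\<close>.
\<close>

lemma exponent_add_eq_iff:
  fixes f g v :: "'n \<Rightarrow> nat"
  shows "f + g = v \<longleftrightarrow> f \<le> v \<and> g = v - f"
proof
  assume "f \<le> v \<and> g = v - f"
  then have "f i + g i = v i" for i
    by (simp add: le_fun_def)
  then show "f + g = v" by (simp add: fun_eq_iff)
next
  assume "f + g = v"
  then have "v = f + g" ..
  then show "f \<le> v \<and> g = v - f" by (simp add: fun_eq_iff le_fun_def)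
qed

lemma count_list_Cons_fun: "count_list (i # w) = unit_index i + count_list w"
  by (auto simp: fun_eq_iff unit_index_def)

lemma count_list_append_fun: "count_list (w @ w') = count_list w + count_list w'"
  by (auto simp: fun_eq_iff)

text \<open>
  The scalar by which a word differs from its sorted rearrangement in the quantum complete
  intersection.
\<close>

fun normal_coeff :: "('n::{finite,linorder} \<Rightarrow> 'n \<Rightarrow> 'k::field) \<Rightarrow> 'n list \<Rightarrow> 'k" where
  "normal_coeff q [] = 1"
| "normal_coeff q (i # w) = reorder q (unit_index i) (count_list w) * normal_coeff q w"

lemma count_list_Nil_fun: "count_list [] = 0"
  by (simp add: fun_eq_iff)

lemma normal_coeff_append:
  "normal_coeff q (w @ w') = normal_coeff q w * normal_coeff q w' * reorder q (count_list w) (count_list w')"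
proof (induction w)
  case Nil
  show ?case
    by (simp only: append_Nil normal_coeff.simps count_list_Nil_fun reorder_zero_left mult_1 mult_1_right)
next
  case (Cons i w)
  show ?case
    by (simp only: append_Cons normal_coeff.simps Cons.IH count_list_Cons_fun count_list_append_fun
        reorder_add_left reorder_add_right mult_ac)
qed

lemma reorder_unit_sorted:
  assumes "\<And>j. j \<in> set w \<Longrightarrow> i \<le> j"
  shows "reorder q (unit_index i) (count_list w) = 1"
proof (rule reorder_eq_1)
  fix j k :: 'a assume "j < k"
  then show "unit_index i k = (0::nat) \<or> count_list w j = 0"
    using assms[of j] by (auto simp: unit_index_def count_list_0_iff)
qed

lemma normal_coeff_sorted: "sorted w \<Longrightarrow> normal_coeff q w = 1"
  by (induction w) (auto intro: reorder_unit_sorted)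

definition standard_word :: "('n::{finite,linorder} \<Rightarrow> nat) \<Rightarrow> 'n list" where
  "standard_word v = concat (map (\<lambda>i. replicate (v i) i) (sorted_list_of_set UNIV))"

lemma sorted_standard_word: "sorted (standard_word v)"
proof -
  have "sorted (concat (map (\<lambda>i. replicate (v i) i) l))" if "sorted l" for l :: "'a list"
    using that by (induction l) (auto simp: sorted_append)
  then show ?thesis by (simp add: standard_word_def)
qed

lemma count_standard_word [simp]: "count_list (standard_word v) = v"
proof
  fix j :: 'a
  have rep: "count_list (replicate n i) j = (if i = j then n else 0)" for n i
    by (induction n) auto
  have "count_list (concat (map (\<lambda>i. replicate (v i) i) l)) j = (if j \<in> set l then v j else 0)"
    if "distinct l" for l :: "'a list"
    using that by (induction l) (auto simp: rep)
  then show "count_list (standard_word v) j = v j"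
    by (simp add: standard_word_def)
qed

text \<open>
  A sorted word is determined by its letter counts.
\<close>

lemma sort_eq_standard_word: "sort w = standard_word (count_list w)"
proof (rule properties_for_sort)
  show "mset (standard_word (count_list w)) = mset w"
    by (rule multiset_eqI) (metis count_mset count_standard_word)
qed (rule sorted_standard_word)

lemma standard_word_zero: "standard_word 0 = []"
  by (metis count_list_Nil_fun sort_eq_standard_word sort_key_simps(1))

lemma standard_word_unit_add: "standard_word (unit_index i + v) = insort i (standard_word v)"
proof -
  have "sort (i # standard_word v) = standard_word (unit_index i + v)"
    by (simp only: sort_eq_standard_word count_list_Cons_fun count_standard_word)
  then show ?thesis
    by (simp only: sort_key_simps sorted_sort_id[OF sorted_standard_word])
qed

section \<open>The quotient algebra\<close>

locale quantum_ci =
  fixes q :: "'n::{finite,linorder} \<Rightarrow> 'n \<Rightarrow> 'k::field" and a :: "'n \<Rightarrow> nat"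
  assumes params: "qci_params q a"
begin

abbreviation "R \<equiv> qci q a"
abbreviation "cls \<equiv> qci_class q a"
abbreviation "I \<equiv> qci_ideal q a"
abbreviation "V \<equiv> basis_index a"
abbreviation "e \<equiv> qci_monomial q a"
abbreviation "word w \<equiv> Poly_Mapping.single w (1::'k)"

lemma a_ge_2: "a i \<ge> 2" and q_diag [simp]: "q i i = 1" and q_inv [simp]: "q i j * q j i = 1"
  using params by (auto simp: qci_params_def)

lemma q_nonzero [simp]: "q i j \<noteq> 0"
  by (metis q_inv mult_zero_left zero_neq_one)

lemma reorder_nonzero [simp]: "reorder q u v \<noteq> 0"
  by (auto simp: reorder_def)

lemma ideal_I: "ideal I free_algebra"
  unfolding qci_ideal_def
  by (rule ring.genideal_ideal[OF ring_free_algebra])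
     (auto simp: free_algebra_def ring_of_type_algebra_def)

lemma relators_I: "qci_relators q a \<subseteq> I"
  unfolding qci_ideal_def
  by (rule ring.genideal_self[OF ring_free_algebra])
     (auto simp: free_algebra_def ring_of_type_algebra_def)

lemma I_add: "x \<in> I \<Longrightarrow> y \<in> I \<Longrightarrow> x + y \<in> I"
  using additive_subgroup.a_closed[OF ideal.axioms(1)[OF ideal_I]]
  by (auto simp: free_algebra_def ring_of_type_algebra_def)

lemma I_zero: "0 \<in> I"
  using additive_subgroup.zero_closed[OF ideal.axioms(1)[OF ideal_I]]
  by (auto simp: free_algebra_def ring_of_type_algebra_def)

lemma I_mult_left: "x \<in> I \<Longrightarrow> p * x \<in> I" and I_mult_right: "x \<in> I \<Longrightarrow> x * p \<in> I"
  using ideal.I_l_closed[OF ideal_I] ideal.I_r_closed[OF ideal_I]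
  by (auto simp: free_algebra_def ring_of_type_algebra_def)

lemma I_uminus: "x \<in> I \<Longrightarrow> - x \<in> I"
  using I_mult_left[of x "-1"] by simp

lemma cls_eq_iff: "cls p = cls r \<longleftrightarrow> p - r \<in> I"
proof -
  have cls: "cls p = {h + p | h. h \<in> I}" for p
    by (auto simp: qci_class_def a_r_coset_def r_coset_def free_algebra_def ring_of_type_algebra_def)
  show ?thesis
  proof
    assume "cls p = cls r"
    moreover have "p \<in> cls p" using I_zero by (force simp: cls)
    ultimately show "p - r \<in> I" by (auto simp: cls)
  next
    assume *: "p - r \<in> I"
    have "h + p = (h + (p - r)) + r" "h + r = (h - (p - r)) + p" for h by simp_all
    moreover have "h + (p - r) \<in> I" "h - (p - r) \<in> I" if "h \<in> I" for h
      using that * I_add I_uminus by (metis add_uminus_conv_diff)+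
    ultimately show "cls p = cls r" unfolding cls by blast
  qed
qed

lemma carrier_R: "carrier R = range cls"
  by (auto simp: qci_def FactRing_def A_RCOSETS_def RCOSETS_def qci_class_def a_r_coset_def
      free_algebra_def ring_of_type_algebra_def)

lemma cls_closed [simp, intro]: "cls p \<in> carrier R"
  by (simp add: carrier_R)

lemma cls_mult: "cls p \<otimes>\<^bsub>R\<^esub> cls r = cls (p * r)"
  using ideal.rcoset_mult_add[OF ideal_I, of p r]
  by (simp add: qci_def FactRing_def qci_class_def free_algebra_def ring_of_type_algebra_def)

lemma cls_add: "cls p \<oplus>\<^bsub>R\<^esub> cls r = cls (p + r)"
  using ideal.a_rcos_sum[OF ideal_I, of p r]
  by (simp add: qci_def FactRing_def qci_class_def free_algebra_def ring_of_type_algebra_def)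

lemma cls_one: "cls 1 = \<one>\<^bsub>R\<^esub>"
  by (simp add: qci_def FactRing_def qci_class_def free_algebra_def ring_of_type_algebra_def)

lemma cls_zero: "cls 0 = \<zero>\<^bsub>R\<^esub>"
  by (auto simp: qci_def FactRing_def qci_class_def free_algebra_def ring_of_type_algebra_def
     a_r_coset_def r_coset_def)

lemma smult_cls: "c \<odot>\<^bsub>R\<^esub> cls p = cls (scalar c * p)"
proof -
  have "c \<odot>\<^bsub>R\<^esub> cls p = cls (scalar c) \<otimes>\<^bsub>R\<^esub> cls p"
    by (simp add: qci_def Let_def)
  then show ?thesis by (simp add: cls_mult)
qed

text \<open>
  The quotient map is a surjective homomorphism, so identities between elements of the quotient are
  checked on representatives, where the arithmetic of a type class is available.
\<close>

lemma carrierE: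
  assumes "x \<in> carrier R"
  obtains p where "x = cls p"
  using assms by (auto simp: carrier_R)

lemma ring_R: "ring R"
proof (rule ringI)
  show "abelian_group R"
  proof (rule abelian_groupI)
    fix x assume "x \<in> carrier R"
    then obtain p where p: "x = cls p" by (rule carrierE)
    show "\<exists>y\<in>carrier R. y \<oplus>\<^bsub>R\<^esub> x = \<zero>\<^bsub>R\<^esub>"
      by (rule bexI[of _ "cls (- p)"]) (simp_all add: p cls_add cls_zero)
  qed (auto elim!: carrierE simp: cls_add add_ac simp flip: cls_zero)
  show "Group.monoid R"
    by (rule monoidI) (auto elim!: carrierE simp: cls_mult mult.assoc simp flip: cls_one)
qed (auto elim!: carrierE simp: cls_add cls_mult distrib_left distrib_right)

lemma add_closed [simp, intro]: "x \<in> carrier R \<Longrightarrow> y \<in> carrier R \<Longrightarrow> x \<oplus>\<^bsub>R\<^esub> y \<in> carrier R"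
  and mult_closed [simp, intro]: "x \<in> carrier R \<Longrightarrow> y \<in> carrier R \<Longrightarrow> x \<otimes>\<^bsub>R\<^esub> y \<in> carrier R"
  and smult_closed [simp, intro]: "x \<in> carrier R \<Longrightarrow> c \<odot>\<^bsub>R\<^esub> x \<in> carrier R"
  by (auto elim!: carrierE simp: cls_add cls_mult smult_cls)

lemma zero_closed [simp, intro]: "\<zero>\<^bsub>R\<^esub> \<in> carrier R"
  and one_closed [simp, intro]: "\<one>\<^bsub>R\<^esub> \<in> carrier R"
  by (simp_all flip: cls_zero cls_one)

lemma smult_mult_left: "x \<in> carrier R \<Longrightarrow> y \<in> carrier R \<Longrightarrow>
    (c \<odot>\<^bsub>R\<^esub> x) \<otimes>\<^bsub>R\<^esub> y = c \<odot>\<^bsub>R\<^esub> (x \<otimes>\<^bsub>R\<^esub> y)"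
  by (auto elim!: carrierE simp: cls_mult smult_cls mult.assoc)

lemma smult_mult_right: "x \<in> carrier R \<Longrightarrow> y \<in> carrier R \<Longrightarrow>
    x \<otimes>\<^bsub>R\<^esub> (c \<odot>\<^bsub>R\<^esub> y) = c \<odot>\<^bsub>R\<^esub> (x \<otimes>\<^bsub>R\<^esub> y)"
proof (elim carrierE)
  fix p r assume "x = cls p" "y = cls r"
  moreover have "p * (scalar c * r) = scalar c * (p * r)"
    by (metis mult.assoc scalar_central)
  ultimately show ?thesis by (simp add: cls_mult smult_cls)
qed

lemma scalar_mult_scalar: "scalar c * (scalar d * p) = scalar (c * d) * p"
  for p :: "'n list \<Rightarrow>\<^sub>0 'k"
  by (simp add: scalar_def mult_single plus_list_def flip: mult.assoc)

lemma smult_smult: "x \<in> carrier R \<Longrightarrow> c \<odot>\<^bsub>R\<^esub> (d \<odot>\<^bsub>R\<^esub> x) = (c * d) \<odot>\<^bsub>R\<^esub> x"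
  by (auto elim!: carrierE simp: smult_cls scalar_mult_scalar)

lemma smult_one: "x \<in> carrier R \<Longrightarrow> 1 \<odot>\<^bsub>R\<^esub> x = x"
  by (auto elim!: carrierE simp: smult_cls scalar_def single_Nil)

lemma smult_zero: "x \<in> carrier R \<Longrightarrow> 0 \<odot>\<^bsub>R\<^esub> x = \<zero>\<^bsub>R\<^esub>"
  by (auto elim!: carrierE simp: smult_cls scalar_def cls_zero)

lemma smult_zero_right: "c \<odot>\<^bsub>R\<^esub> \<zero>\<^bsub>R\<^esub> = \<zero>\<^bsub>R\<^esub>"
  by (simp add: smult_cls flip: cls_zero)

section \<open>The standard basis\<close>

text \<open>
  A new letter is moved to its place in a sorted word one transposition at a time; each
  transposition contributes one factor of the reordering coefficient.
\<close>

lemma insort_word: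
  "sorted w \<Longrightarrow> cls (Poly_Mapping.single (i # w) c) =
     cls (Poly_Mapping.single (insort i w) (reorder q (unit_index i) (count_list w) * c))"
proof (induction w arbitrary: c)
  case Nil
  show ?case
    by (simp only: count_list_Nil_fun reorder_zero_right insort_key.simps mult_1)
next
  case (Cons j w)
  show ?case
  proof (cases "i \<le> j")
    case True
    then have "reorder q (unit_index i) (count_list (j # w)) = 1"
      using Cons.prems by (intro reorder_unit_sorted) auto
    with True show ?thesis by (simp del: count_list.simps)
  next
    case False
    \<comment> \<open>The relation \<open>x\<^sub>i x\<^sub>j = q\<^sub>j\<^sub>i x\<^sub>j x\<^sub>i\<close>, with the two letters in the order in which they need swapping.\<close>
    let ?r = "letter i * letter j - scalar (q j i) * letter j * letter i :: 'n list \<Rightarrow>\<^sub>0 'k"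
    have "?r \<in> I"
      using relators_I by (auto simp: qci_relators_def)
    then have "?r * Poly_Mapping.single w c \<in> I"
      by (rule I_mult_right)
    also have "?r * Poly_Mapping.single w c =
        Poly_Mapping.single (i # j # w) c - Poly_Mapping.single (j # i # w) (q j i * c)"
      by (simp add: letter_def scalar_def mult_single plus_list_def left_diff_distrib)
    finally have "cls (Poly_Mapping.single (i # j # w) c) =
        cls (Poly_Mapping.single (j # i # w) (q j i * c))"
      by (simp add: cls_eq_iff)
    also have "\<dots> = cls (letter j) \<otimes>\<^bsub>R\<^esub> cls (Poly_Mapping.single (i # w) (q j i * c))"
      by (simp add: cls_mult letter_def mult_single plus_list_def)
    also have "\<dots> = cls (letter j) \<otimes>\<^bsub>R\<^esub> cls (Poly_Mapping.single (insort i w)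
        (reorder q (unit_index i) (count_list w) * (q j i * c)))"
      using Cons.prems by (simp add: Cons.IH)
    also have "\<dots> = cls (Poly_Mapping.single (j # insort i w)
        (reorder q (unit_index i) (count_list w) * (q j i * c)))"
      by (simp add: cls_mult letter_def mult_single plus_list_def)
    also have "reorder q (unit_index i) (count_list w) * (q j i * c) =
        reorder q (unit_index i) (count_list (j # w)) * c"
      using False by (simp only: count_list_Cons_fun reorder_add_right reorder_unit_unit) simp
    finally show ?thesis using False by (simp del: count_list.simps)
  qed
qed

text \<open>
  Sorting by insertion: this is where the sorted monomials are seen to span.
\<close>

lemma word_eq_standard:
  "cls (Poly_Mapping.single w c) =
     cls (Poly_Mapping.single (standard_word (count_list w)) (normal_coeff q w * c))"
proof (induction w arbitrary: c)
  case Nil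
  show ?case
    by (simp only: normal_coeff.simps mult_1 count_list_Nil_fun standard_word_zero)
next
  case (Cons i w)
  let ?s = "standard_word (count_list w)"
  have "cls (Poly_Mapping.single (i # w) c) = cls (letter i) \<otimes>\<^bsub>R\<^esub> cls (Poly_Mapping.single w c)"
    by (simp add: cls_mult letter_def mult_single plus_list_def)
  also have "\<dots> = cls (letter i) \<otimes>\<^bsub>R\<^esub> cls (Poly_Mapping.single ?s (normal_coeff q w * c))"
    by (simp only: Cons.IH)
  also have "\<dots> = cls (Poly_Mapping.single (i # ?s) (normal_coeff q w * c))"
    by (simp add: cls_mult letter_def mult_single plus_list_def)
  also have "\<dots> = cls (Poly_Mapping.single (insort i ?s)
      (reorder q (unit_index i) (count_list ?s) * (normal_coeff q w * c)))"
    by (rule insort_word[OF sorted_standard_word])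
  also have "insort i ?s = standard_word (count_list (i # w))"
    by (simp only: count_list_Cons_fun standard_word_unit_add)
  finally show ?case
    by (simp add: mult.assoc del: count_list.simps)
qed

lemma cls_letter_power: "cls (letter i) [^]\<^bsub>R\<^esub> k = cls (letter i ^ k)" for k :: nat
proof -
  interpret ring R by (rule ring_R)
  show ?thesis
    by (induction k) (simp_all add: cls_one cls_mult power_Suc2 del: power_Suc)
qed

lemma monomial_eq: "e v = cls (word (standard_word v))"
proof -
  have "foldr (\<lambda>i y. (qci_gen q a i [^]\<^bsub>R\<^esub> v i) \<otimes>\<^bsub>R\<^esub> y) l \<one>\<^bsub>R\<^esub> =
      cls (word (concat (map (\<lambda>i. replicate (v i) i) l)))" for l
  proof (induction l)
    case Nil
    then show ?case by (simp add: cls_one single_Nil)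
  next
    case (Cons i l)
    then show ?case
      by (simp add: qci_gen_def cls_letter_power letter_power cls_mult mult_single plus_list_def)
  qed
  then show ?thesis by (simp add: qci_monomial_def standard_word_def)
qed

lemma monomial_closed [simp, intro]: "e v \<in> carrier R"
  by (simp add: monomial_eq)

lemma cls_word: "cls (Poly_Mapping.single w c) = (normal_coeff q w * c) \<odot>\<^bsub>R\<^esub> e (count_list w)"
  by (subst word_eq_standard) (simp add: monomial_eq smult_cls)

lemma monomial_mult: "e u \<otimes>\<^bsub>R\<^esub> e v = reorder q u v \<odot>\<^bsub>R\<^esub> e (u + v)"
proof -
  have "e u \<otimes>\<^bsub>R\<^esub> e v = cls (word (standard_word u @ standard_word v))"
    by (simp add: monomial_eq cls_mult mult_single plus_list_def)
  also have "\<dots> = reorder q u v \<odot>\<^bsub>R\<^esub> e (u + v)"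
    by (subst cls_word)
       (simp only: normal_coeff_append normal_coeff_sorted[OF sorted_standard_word]
         count_standard_word count_list_append_fun mult_1 mult_1_right)
  finally show ?thesis .
qed

lemma monomial_zero [simp]: "e 0 = \<one>\<^bsub>R\<^esub>"
  by (simp add: monomial_eq standard_word_zero cls_one single_Nil)

lemma monomial_unit: "e (unit_index i) = qci_gen q a i"
proof -
  have "standard_word (unit_index i) = [i]"
    using standard_word_unit_add[of i 0] by (simp only: add_0_right standard_word_zero insort_key.simps)
  then show ?thesis
    by (simp add: monomial_eq qci_gen_def letter_def)
qed

text \<open>
  The standard word of \<open>v\<close> contains the block of all letters \<open>i\<close>; once it has at least \<open>a i\<close> of them,
  a relator \<open>x\<^sub>i\<^bsup>a i\<^esup>\<close> divides the word.
\<close>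

lemma monomial_outside:
  assumes "v \<notin> V"
  shows "e v = \<zero>\<^bsub>R\<^esub>"
proof -
  from assms obtain i where "\<not> v i \<le> a i - 1"
    by (auto simp: basis_index_def)
  then have "a i \<le> v i" by simp
  then obtain k where k: "v i = a i + k" using le_Suc_ex by blast
  obtain l l' where "sorted_list_of_set (UNIV :: 'n set) = l @ i # l'"
    using split_list[of i "sorted_list_of_set (UNIV :: 'n set)"] by auto
  then obtain w w' where w: "standard_word v = w @ replicate (a i) i @ w'"
    by (simp add: standard_word_def k replicate_add)
  have "letter i ^ a i \<in> I"
    using relators_I by (auto simp: qci_relators_def)
  then have "word w * (letter i ^ a i * word w') \<in> I"
    by (intro I_mult_left I_mult_right)
  then have "cls (word (standard_word v)) = cls 0"
    by (simp add: cls_eq_iff w letter_power mult_single plus_list_def)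
  then show ?thesis by (simp add: monomial_eq cls_zero)
qed

text \<open>
  The prospective coefficient of \<open>x\<^sub>v\<close> in the class of the word \<open>w\<close>.
\<close>

definition word_coord :: "('n \<Rightarrow> nat) \<Rightarrow> 'n list \<Rightarrow> 'k" where
  "word_coord v w = (if count_list w = v then normal_coeff q w else 0)"

definition coords_vanish :: "('n list \<Rightarrow>\<^sub>0 'k) set" where
  "coords_vanish = {p. \<forall>v\<in>V. lin_ext (word_coord v) p = 0}"

lemma V_downward: "v \<in> V \<Longrightarrow> u \<le> v \<Longrightarrow> u \<in> V"
  by (auto simp: basis_index_def le_fun_def intro: order_trans)

text \<open>
  Multiplication by a word shifts the index of the coordinate functionals and rescales them.
\<close>

lemma word_coord_append:
  "word_coord v (w @ w') = (if count_list w \<le> v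
     then normal_coeff q w * reorder q (count_list w) (v - count_list w) * word_coord (v - count_list w) w'
     else 0)"
  "word_coord v (w @ w') = (if count_list w' \<le> v
     then normal_coeff q w' * reorder q (v - count_list w') (count_list w') * word_coord (v - count_list w') w
     else 0)"
proof -
  have 1: "count_list (w @ w') = v \<longleftrightarrow> count_list w \<le> v \<and> count_list w' = v - count_list w"
    unfolding count_list_append_fun by (rule exponent_add_eq_iff)
  have 2: "count_list (w @ w') = v \<longleftrightarrow> count_list w' \<le> v \<and> count_list w = v - count_list w'"
    unfolding count_list_append_fun add.commute[of "count_list w"] by (rule exponent_add_eq_iff)
  show "word_coord v (w @ w') = (if count_list w \<le> v
     then normal_coeff q w * reorder q (count_list w) (v - count_list w) * word_coord (v - count_list w) w'
     else 0)"
    unfolding word_coord_def normal_coeff_append 1 by auto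
  show "word_coord v (w @ w') = (if count_list w' \<le> v
     then normal_coeff q w' * reorder q (v - count_list w') (count_list w') * word_coord (v - count_list w') w
     else 0)"
    unfolding word_coord_def normal_coeff_append 2 by auto
qed

text \<open>
  The shifted index \<open>v - count_list w\<close> stays in \<open>V\<close>, since \<open>V\<close> is closed downwards; this makes the
  common kernel of the functionals a two-sided ideal.
\<close>

lemma coords_vanish_times_word:
  assumes "p \<in> coords_vanish"
  shows "Poly_Mapping.single w c * p \<in> coords_vanish" "p * Poly_Mapping.single w c \<in> coords_vanish"
proof -
  have "lin_ext (word_coord v) (Poly_Mapping.single w c * p) = 0 \<and>
        lin_ext (word_coord v) (p * Poly_Mapping.single w c) = 0" if "v \<in> V" for v
  proof (cases "count_list w \<le> v")
    case True
    have "v - count_list w \<in> V"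
      by (rule V_downward[OF that]) (simp add: le_fun_def)
    then have "lin_ext (word_coord (v - count_list w)) p = 0"
      using assms by (simp add: coords_vanish_def)
    with True show ?thesis
      by (simp add: lin_ext_single_times lin_ext_times_single word_coord_append(1)[of v w]
          word_coord_append(2)[of v _ w] lin_ext_scaled)
  next
    case False
    then show ?thesis
      by (simp add: lin_ext_single_times lin_ext_times_single word_coord_append(1)[of v w]
          word_coord_append(2)[of v _ w]) (simp add: lin_ext_def)
  qed
  then show "Poly_Mapping.single w c * p \<in> coords_vanish" "p * Poly_Mapping.single w c \<in> coords_vanish"
    by (simp_all add: coords_vanish_def)
qed

lemma coords_vanish_add: "p \<in> coords_vanish \<Longrightarrow> r \<in> coords_vanish \<Longrightarrow> p + r \<in> coords_vanish"
  by (simp add: coords_vanish_def lin_ext_add)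

lemma coords_vanish_times:
  assumes "p \<in> coords_vanish"
  shows "r * p \<in> coords_vanish" "p * r \<in> coords_vanish"
proof -
  have "r * p \<in> coords_vanish \<and> p * r \<in> coords_vanish"
  proof (induction r rule: poly_mapping_additive_induct)
    case zero
    then show ?case by (simp add: coords_vanish_def)
  qed (simp_all add: coords_vanish_times_word assms distrib_left distrib_right coords_vanish_add)
  then show "r * p \<in> coords_vanish" "p * r \<in> coords_vanish" by auto
qed

lemma relators_coords_vanish: "qci_relators q a \<subseteq> coords_vanish"
proof -
  have "letter i ^ a i \<in> coords_vanish" for i
  proof -
    have *: "count_list (replicate n i) i = n" for n by (induction n) auto
    have "count_list (replicate (a i) i) \<noteq> v" if "v \<in> V" for v
    proof
      assume "count_list (replicate (a i) i) = v"
      then have "v i = a i" using *[of "a i"] by simp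
      moreover have "v i \<le> a i - 1" using that by (simp add: basis_index_def)
      ultimately show False using a_ge_2[of i] by simp
    qed
    then show ?thesis
      by (auto simp: coords_vanish_def letter_power word_coord_def)
  qed
  moreover have "letter j * letter i - scalar (q i j) * letter i * letter j \<in> coords_vanish" for i j
  proof -
    have c: "count_list [j, i] = count_list [i, j]"
      by (auto simp: fun_eq_iff)
    have n: "normal_coeff q [x, y] = (if y < x then q y x else 1)" for x y
    proof -
      have "normal_coeff q [x, y] = reorder q (unit_index x) (unit_index y)"
        by (simp only: normal_coeff.simps count_list_Cons_fun count_list_Nil_fun reorder_zero_right
            add_0_right mult_1_right)
      then show ?thesis by (simp add: reorder_unit_unit)
    qed
    have "normal_coeff q [j, i] = q i j * normal_coeff q [i, j]"
      unfolding n by (cases i j rule: linorder_cases) auto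
    then have "word_coord v [j, i] = q i j * word_coord v [i, j]" for v
      unfolding word_coord_def c by simp
    then show ?thesis
      by (simp add: coords_vanish_def letter_def scalar_def mult_single plus_list_def lin_ext_diff)
  qed
  ultimately show ?thesis
    by (auto simp: qci_relators_def)
qed

text \<open>
  The common kernel of the coordinate functionals is a two-sided ideal that contains the relators, so
  the functionals survive in the quotient.
\<close>

lemma I_coords_vanish: "I \<subseteq> coords_vanish"
  unfolding qci_ideal_def
proof (rule ring.genideal_minimal[OF ring_free_algebra _ relators_coords_vanish])
  interpret F: ring "free_algebra :: ('n list \<Rightarrow>\<^sub>0 'k) ring"
    by (rule ring_free_algebra)
  have "\<ominus>\<^bsub>free_algebra\<^esub> p = - p" for p :: "'n list \<Rightarrow>\<^sub>0 'k"
    by (rule F.minus_equality) (simp_all add: free_algebra_def ring_of_type_algebra_def)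
  then have "subgroup coords_vanish (add_monoid (free_algebra :: ('n list \<Rightarrow>\<^sub>0 'k) ring))"
    by (intro F.add.subgroupI)
       (auto simp: free_algebra_def ring_of_type_algebra_def coords_vanish_def lin_ext_uminus lin_ext_add
         intro: exI[of _ 0])
  then show "ideal coords_vanish (free_algebra :: ('n list \<Rightarrow>\<^sub>0 'k) ring)"
    by (rule idealI[OF ring_free_algebra])
       (auto simp: free_algebra_def ring_of_type_algebra_def coords_vanish_times)
qed

text \<open>
  Coordinates are read off from an arbitrary representative, which is legitimate only for
  \<open>v \<in> V\<close> (see \<open>coord_cls\<close>).
\<close>

definition coord :: "('n \<Rightarrow> nat) \<Rightarrow> ('n list \<Rightarrow>\<^sub>0 'k) set \<Rightarrow> 'k" where
  "coord v x = lin_ext (word_coord v) (SOME p. x = cls p)"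

lemma coord_cls:
  assumes "v \<in> V"
  shows "coord v (cls p) = lin_ext (word_coord v) p"
proof -
  define r where "r = (SOME r. cls p = cls r)"
  have "cls p = cls r" unfolding r_def by (rule someI) (rule refl)
  then have "p - r \<in> coords_vanish"
    using I_coords_vanish by (auto simp: cls_eq_iff)
  then have "lin_ext (word_coord v) (p - r) = 0"
    using assms by (simp add: coords_vanish_def)
  then show ?thesis
    by (simp add: coord_def lin_ext_diff flip: r_def)
qed

lemma linear_form_coord: "v \<in> V \<Longrightarrow> linear_form R (coord v)"
  unfolding linear_form_def
  by (auto elim!: carrierE simp: cls_add smult_cls coord_cls lin_ext_add lin_ext_scalar_times)

lemma coord_monomial: "v \<in> V \<Longrightarrow> coord v (e u) = (if u = v then 1 else 0)"
  by (simp add: monomial_eq coord_cls word_coord_def normal_coeff_sorted sorted_standard_word)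

lemma finite_V [simp]: "finite V"
proof -
  have "V = PiE UNIV (\<lambda>i. {..a i - 1})"
    by (auto simp: basis_index_def PiE_def Pi_def)
  then show ?thesis by (simp add: finite_PiE)
qed

lemma linear_form_0: "linear_form R f \<Longrightarrow> f \<zero>\<^bsub>R\<^esub> = 0"
  unfolding linear_form_def using smult_zero[of "\<zero>\<^bsub>R\<^esub>"] zero_closed by (metis mult_zero_left)

lemma linear_form_add: "linear_form R f \<Longrightarrow> x \<in> carrier R \<Longrightarrow> y \<in> carrier R \<Longrightarrow>
    f (x \<oplus>\<^bsub>R\<^esub> y) = f x + f y"
  and linear_form_smult: "linear_form R f \<Longrightarrow> x \<in> carrier R \<Longrightarrow> f (c \<odot>\<^bsub>R\<^esub> x) = c * f x"
  by (auto simp: linear_form_def)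

lemma linear_form_expand_cls:
  assumes "linear_form R f"
  shows "f (cls p) = (\<Sum>v\<in>V. lin_ext (word_coord v) p * f (e v))"
proof (induction p rule: poly_mapping_additive_induct)
  case zero
  show ?case using linear_form_0[OF assms] by (simp add: cls_zero)
next
  case (single w c)
  have "f (cls (Poly_Mapping.single w c)) = c * normal_coeff q w * f (e (count_list w))"
    by (simp add: cls_word linear_form_smult[OF assms])
  also have "\<dots> = (\<Sum>v\<in>V. if v = count_list w then c * normal_coeff q w * f (e v) else 0)"
    using monomial_outside[of "count_list w"] linear_form_0[OF assms] by (auto simp: sum.delta)
  also have "\<dots> = (\<Sum>v\<in>V. lin_ext (word_coord v) (Poly_Mapping.single w c) * f (e v))"
    by (intro sum.cong) (auto simp: word_coord_def)
  finally show ?case .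
next
  case (add p r)
  then show ?case
    by (simp add: linear_form_add[OF assms] lin_ext_add distrib_right sum.distrib flip: cls_add)
qed

text \<open>
  The monomials indexed by \<open>V\<close> span. Stating this through linear forms turns every later computation
  in the algebra into one in the ground field.
\<close>

lemma linear_form_expand:
  assumes "linear_form R f" "x \<in> carrier R"
  shows "f x = (\<Sum>v\<in>V. coord v x * f (e v))"
  using assms(2) by (auto elim!: carrierE simp: linear_form_expand_cls[OF assms(1)] coord_cls)

lemma cls_eq_normal_form:
  "cls p = cls (\<Sum>v\<in>V. Poly_Mapping.single (standard_word v) (lin_ext (word_coord v) p))"
proof (induction p rule: poly_mapping_additive_induct)
  case zero
  show ?case by simp
next
  case (single w c)
  have "(\<Sum>v\<in>V. Poly_Mapping.single (standard_word v) (lin_ext (word_coord v) (Poly_Mapping.single w c))) =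
      (\<Sum>v\<in>V. if v = count_list w
         then Poly_Mapping.single (standard_word v) (normal_coeff q w * c) else 0)"
    by (intro sum.cong) (auto simp: word_coord_def mult.commute)
  also have "\<dots> = (if count_list w \<in> V
      then Poly_Mapping.single (standard_word (count_list w)) (normal_coeff q w * c) else 0)"
    by (simp add: sum.delta)
  finally have sum: "(\<Sum>v\<in>V. Poly_Mapping.single (standard_word v)
        (lin_ext (word_coord v) (Poly_Mapping.single w c))) =
      (if count_list w \<in> V
       then Poly_Mapping.single (standard_word (count_list w)) (normal_coeff q w * c) else 0)" .
  show ?case
  proof (cases "count_list w \<in> V")
    case True
    then show ?thesis unfolding sum using word_eq_standard[of w c] by simp
  next
    case False
    then show ?thesis
      unfolding sum using cls_word[of w c] by (simp add: monomial_outside cls_zero smult_zero_right)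
  qed
next
  case (add p r)
  have "cls (p + r) = cls p \<oplus>\<^bsub>R\<^esub> cls r"
    by (simp add: cls_add)
  also have "\<dots> = cls ((\<Sum>v\<in>V. Poly_Mapping.single (standard_word v) (lin_ext (word_coord v) p)) +
      (\<Sum>v\<in>V. Poly_Mapping.single (standard_word v) (lin_ext (word_coord v) r)))"
    by (subst add.IH(1), subst add.IH(2), rule cls_add)
  finally show ?case
    by (simp only: lin_ext_add single_add sum.distrib)
qed

text \<open>
  Linear forms separate points; with \<open>coord_monomial\<close> this says that the monomials indexed by \<open>V\<close>
  are a basis.
\<close>

lemma coord_eqI:
  assumes "x \<in> carrier R" "y \<in> carrier R" "\<And>v. v \<in> V \<Longrightarrow> coord v x = coord v y"
  shows "x = y"
proof -
  obtain p r where x: "x = cls p" and y: "y = cls r"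
    using assms(1,2) by (auto elim!: carrierE)
  have *: "lin_ext (word_coord v) p = lin_ext (word_coord v) r" if "v \<in> V" for v
    using assms(3)[OF that] that by (simp add: x y coord_cls)
  have "(\<Sum>v\<in>V. Poly_Mapping.single (standard_word v) (lin_ext (word_coord v) p)) =
      (\<Sum>v\<in>V. Poly_Mapping.single (standard_word v) (lin_ext (word_coord v) r))"
    by (rule sum.cong) (simp_all only: *)
  then show ?thesis
    unfolding x y cls_eq_normal_form[of p] cls_eq_normal_form[of r] by (rule arg_cong)
qed

section \<open>The socle\<close>

abbreviation "topv \<equiv> top_index a"
abbreviation deg :: "('n \<Rightarrow> nat) \<Rightarrow> nat" where "deg v \<equiv> (\<Sum>i\<in>UNIV. v i)"

lemma V_iff: "v \<in> V \<longleftrightarrow> v \<le> topv"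
  by (simp add: basis_index_def top_index_def le_fun_def)

lemma top_V [simp]: "topv \<in> V"
  by (simp add: V_iff)

lemma zero_V [simp]: "0 \<in> V"
  by (simp add: V_iff le_fun_def)

lemma add_diff_top: "v \<in> V \<Longrightarrow> v + (topv - v) = topv"
  by (simp add: exponent_add_eq_iff V_iff)

lemma deg_strict_mono:
  assumes "u \<le> v" "u \<noteq> v"
  shows "deg u < deg v"
proof (rule sum_strict_mono_ex1)
  show "\<forall>i\<in>UNIV. u i \<le> v i" using assms(1) by (simp add: le_fun_def)
  have "\<exists>i. u i \<noteq> v i" using assms(2) by (simp add: fun_eq_iff)
  then show "\<exists>i\<in>UNIV. u i < v i" using assms(1) by (metis UNIV_I le_fun_def le_neq_implies_less)
qed simp

lemma linear_form_mult_left: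
  assumes "linear_form R f" "z \<in> carrier R"
  shows "linear_form R (\<lambda>x. f (z \<otimes>\<^bsub>R\<^esub> x))"
proof -
  interpret R: ring R by (rule ring_R)
  show ?thesis
    using assms by (auto simp: linear_form_def R.r_distr smult_mult_right)
qed

lemma linear_form_mult_right:
  assumes "linear_form R f" "z \<in> carrier R"
  shows "linear_form R (\<lambda>x. f (x \<otimes>\<^bsub>R\<^esub> z))"
proof -
  interpret R: ring R by (rule ring_R)
  show ?thesis
    using assms by (auto simp: linear_form_def R.l_distr smult_mult_left)
qed

lemma linear_form_monomial_mult:
  assumes "linear_form R f"
  shows "f (e u \<otimes>\<^bsub>R\<^esub> e v) = (if u + v \<in> V then reorder q u v * f (e (u + v)) else 0)"
  by (auto simp: monomial_mult linear_form_smult[OF assms] monomial_outside smult_zero_right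
      linear_form_0[OF assms])

lemma coord_smult: "v \<in> V \<Longrightarrow> x \<in> carrier R \<Longrightarrow> coord v (k \<odot>\<^bsub>R\<^esub> x) = k * coord v x"
  by (rule linear_form_smult[OF linear_form_coord])

lemma coord_add: "v \<in> V \<Longrightarrow> x \<in> carrier R \<Longrightarrow> y \<in> carrier R \<Longrightarrow>
    coord v (x \<oplus>\<^bsub>R\<^esub> y) = coord v x + coord v y"
  by (rule linear_form_add[OF linear_form_coord])

lemma coord_zero: "v \<in> V \<Longrightarrow> coord v \<zero>\<^bsub>R\<^esub> = 0"
  by (rule linear_form_0[OF linear_form_coord])

lemma coord_mult_monomial:
  assumes "w \<in> V" "x \<in> carrier R"
  shows "coord w (x \<otimes>\<^bsub>R\<^esub> e u) =
    (if u \<le> w then reorder q (w - u) u * coord (w - u) x else 0)"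
proof -
  have eq: "v + u = w \<longleftrightarrow> u \<le> w \<and> v = w - u" for v
    unfolding add.commute[of v] by (rule exponent_add_eq_iff)
  then have diff_add: "w - u + u = w" if "u \<le> w" using that by blast
  have "coord w (x \<otimes>\<^bsub>R\<^esub> e u) = (\<Sum>v\<in>V. coord v x * coord w (e v \<otimes>\<^bsub>R\<^esub> e u))"
    using linear_form_expand[OF linear_form_mult_right[OF linear_form_coord[OF assms(1)]] assms(2)]
    by simp
  also have "\<dots> = (\<Sum>v\<in>V. if v = w - u
      then if u \<le> w then reorder q (w - u) u * coord (w - u) x else 0 else 0)"
    using assms(1)
    by (intro sum.cong) (auto simp: linear_form_monomial_mult[OF linear_form_coord] coord_monomial eq diff_add)
  also have "\<dots> = (if u \<le> w then reorder q (w - u) u * coord (w - u) x else 0)"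
    using V_downward[OF assms(1), of "w - u"] by (auto simp: sum.delta le_fun_def)
  finally show ?thesis .
qed

lemma coord_monomial_mult:
  assumes "w \<in> V" "x \<in> carrier R"
  shows "coord w (e u \<otimes>\<^bsub>R\<^esub> x) =
    (if u \<le> w then reorder q u (w - u) * coord (w - u) x else 0)"
proof -
  have add_diff: "u + (w - u) = w" if "u \<le> w"
    using that exponent_add_eq_iff by blast
  have "coord w (e u \<otimes>\<^bsub>R\<^esub> x) = (\<Sum>v\<in>V. coord v x * coord w (e u \<otimes>\<^bsub>R\<^esub> e v))"
    using linear_form_expand[OF linear_form_mult_left[OF linear_form_coord[OF assms(1)]] assms(2)]
    by simp
  also have "\<dots> = (\<Sum>v\<in>V. if v = w - u
      then if u \<le> w then reorder q u (w - u) * coord (w - u) x else 0 else 0)"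
    using assms(1)
    by (intro sum.cong)
       (auto simp: linear_form_monomial_mult[OF linear_form_coord] coord_monomial
         exponent_add_eq_iff add_diff)
  also have "\<dots> = (if u \<le> w then reorder q u (w - u) * coord (w - u) x else 0)"
    using V_downward[OF assms(1), of "w - u"] by (auto simp: sum.delta le_fun_def)
  finally show ?thesis .
qed

lemma minimal_support:
  assumes "x \<in> carrier R" "x \<noteq> \<zero>\<^bsub>R\<^esub>"
  obtains w where "w \<in> V" "coord w x \<noteq> 0" "\<And>v. v \<in> V \<Longrightarrow> deg v < deg w \<Longrightarrow> coord v x = 0"
proof -
  have "\<exists>w. w \<in> V \<and> coord w x \<noteq> 0"
    using coord_eqI[OF assms(1) zero_closed] assms(2) by (auto simp: coord_zero)
  from ex_has_least_nat[of "\<lambda>w. w \<in> V \<and> coord w x \<noteq> 0" _ deg] this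
  obtain w where "w \<in> V \<and> coord w x \<noteq> 0" "\<And>v. v \<in> V \<and> coord v x \<noteq> 0 \<Longrightarrow> deg w \<le> deg v"
    by blast
  then show thesis
    by (intro that[of w]) (auto simp flip: not_le)
qed

text \<open>
  If \<open>w\<close> has minimal degree in the support of \<open>x\<close>, then \<open>x\<^bsub>a-1-w\<^esub>\<close> kills every other term of \<open>x\<close>:
  a term \<open>v\<close> survives only for \<open>v \<le> w\<close>, and then its degree is smaller unless \<open>v = w\<close>. So the
  product is a multiple of the top monomial.
\<close>

lemma linear_form_socle_shift:
  assumes "linear_form R f" "x \<in> carrier R" "w \<in> V"
    and "\<And>v. v \<in> V \<Longrightarrow> deg v < deg w \<Longrightarrow> coord v x = 0"
  shows "f (x \<otimes>\<^bsub>R\<^esub> e (topv - w)) = coord w x * reorder q w (topv - w) * f (e topv)"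
proof -
  have "f (x \<otimes>\<^bsub>R\<^esub> e (topv - w)) = (\<Sum>v\<in>V. coord v x * f (e v \<otimes>\<^bsub>R\<^esub> e (topv - w)))"
    using linear_form_expand[OF linear_form_mult_right[OF assms(1)] assms(2)] by simp
  also have "\<dots> = (\<Sum>v\<in>V. if v = w then coord w x * reorder q w (topv - w) * f (e topv) else 0)"
  proof (rule sum.cong)
    fix v assume v: "v \<in> V"
    show "coord v x * f (e v \<otimes>\<^bsub>R\<^esub> e (topv - w)) =
        (if v = w then coord w x * reorder q w (topv - w) * f (e topv) else 0)"
    proof (cases "v = w")
      case True
      then show ?thesis
        using assms(3) by (simp add: linear_form_monomial_mult[OF assms(1)] add_diff_top)
    next
      case False
      have "coord v x = 0" if in_V: "v + (topv - w) \<in> V"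
      proof (rule assms(4)[OF v deg_strict_mono[OF _ False]])
        show "v \<le> w"
        proof (rule le_funI)
          fix i
          have "v i + (topv i - w i) \<le> topv i" "w i \<le> topv i"
            using in_V assms(3) by (simp_all add: V_iff le_fun_def)
          then show "v i \<le> w i" by linarith
        qed
      qed
      then show ?thesis
        using False by (auto simp: linear_form_monomial_mult[OF assms(1)])
    qed
  qed simp
  also have "\<dots> = coord w x * reorder q w (topv - w) * f (e topv)"
    using assms(3) by (simp add: sum.delta)
  finally show ?thesis .
qed

text \<open>
  A nonzero difference \<open>x - y\<close> could be moved into the socle by a right multiplication, where \<open>f\<close>
  does not vanish.
\<close>

lemma left_nondegenerate:
  assumes f: "linear_form R f" "f (e topv) \<noteq> 0"
    and "x \<in> carrier R" "y \<in> carrier R"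
    and eq: "\<And>z. z \<in> carrier R \<Longrightarrow> f (x \<otimes>\<^bsub>R\<^esub> z) = f (y \<otimes>\<^bsub>R\<^esub> z)"
  shows "x = y"
proof -
  interpret R: ring R by (rule ring_R)
  \<comment> \<open>The difference of \<open>x\<close> and \<open>y\<close>, written with the scalar \<open>- 1\<close> so that linear forms evaluate on it directly.\<close>
  let ?d = "x \<oplus>\<^bsub>R\<^esub> (- 1) \<odot>\<^bsub>R\<^esub> y"
  have d: "?d \<in> carrier R" using assms by blast
  have "f (?d \<otimes>\<^bsub>R\<^esub> z) = 0" if "z \<in> carrier R" for z
    using assms(3,4) eq[OF that] that
    by (simp add: R.l_distr smult_mult_left linear_form_add[OF f(1)] linear_form_smult[OF f(1)])
  then have "?d = \<zero>\<^bsub>R\<^esub>"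
    using minimal_support[OF d] linear_form_socle_shift[OF f(1) d] f(2)
    by (metis monomial_closed mult_eq_0_iff reorder_nonzero)
  then have "coord v ?d = 0" if "v \<in> V" for v
    using that by (simp add: coord_zero)
  then show ?thesis
    using assms(3,4) by (intro coord_eqI) (simp_all add: coord_add coord_smult)
qed

lemma linear_form_mult_top:
  assumes "linear_form R f" "x \<in> carrier R"
  shows "f (x \<otimes>\<^bsub>R\<^esub> e topv) = coord 0 x * f (e topv)"
proof -
  have "topv - 0 = topv" by (simp add: fun_eq_iff)
  with linear_form_socle_shift[OF assms zero_V] show ?thesis by simp
qed

text \<open>
  The monomials \<open>x\<^sub>v\<close> with \<open>v \<noteq> 0\<close> are nilpotent because \<open>x\<^sub>v\<^sup>2\<close> is a multiple of \<open>x\<^bsub>2v\<^esub>\<close>, so a character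
  kills them; the induction runs downwards on the degree.
\<close>

lemma augmentation_eq_coord:
  assumes "linear_form R \<eta>" "\<eta> \<one>\<^bsub>R\<^esub> = 1"
    and mult: "\<And>x y. x \<in> carrier R \<Longrightarrow> y \<in> carrier R \<Longrightarrow> \<eta> (x \<otimes>\<^bsub>R\<^esub> y) = \<eta> x * \<eta> y"
    and "x \<in> carrier R"
  shows "\<eta> x = coord 0 x"
proof -
  have zero: "\<eta> (e v) = 0" if "v \<in> V" "v \<noteq> 0" for v
    using that
  proof (induction "deg topv - deg v" arbitrary: v rule: less_induct)
    case less
    have sq: "\<eta> (e v) * \<eta> (e v) = (if v + v \<in> V then reorder q v v * \<eta> (e (v + v)) else 0)"
      using mult[of "e v" "e v"] by (simp add: linear_form_monomial_mult[OF assms(1)])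
    have "\<eta> (e (v + v)) = 0" if vv: "v + v \<in> V"
    proof (rule less.hyps[OF _ vv])
      obtain i where "v i \<noteq> 0" using less.prems(2) by (auto simp: fun_eq_iff)
      then have "(v + v) i \<noteq> v i" "(v + v) i \<noteq> 0" by simp_all
      then have ne: "v \<noteq> v + v" and nz: "v + v \<noteq> 0" by (metis, metis zero_fun_apply)
      show "v + v \<noteq> 0" by (rule nz)
      have le: "v \<le> v + v" by (rule le_funI) simp
      have "deg v < deg (v + v)" by (rule deg_strict_mono[OF le ne])
      moreover have "deg (v + v) \<le> deg topv"
        using vv unfolding V_iff le_fun_def by (intro sum_mono) blast
      ultimately show "deg topv - deg (v + v) < deg topv - deg v" by linarith
    qed
    with sq show ?case by (auto split: if_splits)
  qed
  have "\<eta> x = (\<Sum>v\<in>V. if v = 0 then coord 0 x else 0)"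
    unfolding linear_form_expand[OF assms(1,4)]
    by (intro sum.cong) (auto simp: zero assms(2))
  then show ?thesis by (simp add: sum.delta)
qed

text \<open>
  For \<open>v \<in> V\<close> the truncated difference \<open>a - 1 - v\<close> agrees with the integer one.
\<close>

lemma hcoef_eq:
  assumes "v \<in> V"
  shows "hcoef q a (\<lambda>i. int (v i)) = reorder q (topv - v) v / reorder q v (topv - v)"
proof -
  have "int (a i) - 1 - int (v i) = int ((topv - v) i)" for i
  proof -
    have "v i \<le> a i - 1" using assms by (simp add: basis_index_def)
    then show ?thesis using a_ge_2[of i] by (simp add: top_index_def)
  qed
  then show ?thesis
    by (simp add: hcoef_def flip: qpair_of_nat)
qed

text \<open>
  Both sides pick out the coefficient of \<open>x\<^bsub>a-1-v\<^esub>\<close> in \<open>x\<close>, scaled by the two ways of multiplying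
  it with \<open>x\<^sub>v\<close>; the quotient of these scalars is \<open>h\<^sub>v\<close>.
\<close>

lemma top_form_nakayama:
  assumes "v \<in> V" "x \<in> carrier R"
  shows "coord topv (x \<otimes>\<^bsub>R\<^esub> e v) = hcoef q a (\<lambda>i. int (v i)) * coord topv (e v \<otimes>\<^bsub>R\<^esub> x)"
  using assms by (simp add: coord_mult_monomial coord_monomial_mult hcoef_eq V_iff)

lemma sweedler_sum_closed:
  assumes "set s \<subseteq> carrier R \<times> carrier R"
    and "\<And>x y. x \<in> carrier R \<Longrightarrow> y \<in> carrier R \<Longrightarrow> F x y \<in> carrier R"
  shows "sweedler_sum R F s \<in> carrier R"
  using assms(1) by (induction s) (auto simp: sweedler_sum_def assms(2))

lemma linear_form_sweedler_sum:
  assumes "linear_form R f" "set s \<subseteq> carrier R \<times> carrier R"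
    and "\<And>x y. x \<in> carrier R \<Longrightarrow> y \<in> carrier R \<Longrightarrow> F x y \<in> carrier R"
  shows "f (sweedler_sum R F s) = (\<Sum>(x, y)\<leftarrow>s. f (F x y))"
  using assms(2)
proof (induction s)
  case Nil
  then show ?case by (simp add: sweedler_sum_def linear_form_0[OF assms(1)])
next
  case (Cons z s)
  obtain x y where z: "z = (x, y)" by fastforce
  have "sweedler_sum R F s \<in> carrier R"
    using Cons.prems by (intro sweedler_sum_closed assms(3)) auto
  then show ?case
    using Cons by (simp add: sweedler_sum_def z linear_form_add[OF assms(1)] assms(3))
qed

end

section \<open>Bi-Frobenius structures\<close>

locale bi_frobenius_qci = quantum_ci q a
  for q :: "'n::{finite,linorder} \<Rightarrow> 'n \<Rightarrow> 'k::field" and a :: "'n \<Rightarrow> nat" +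
  fixes \<Delta> :: "('n list \<Rightarrow>\<^sub>0 'k) set \<Rightarrow> (('n list \<Rightarrow>\<^sub>0 'k) set \<times> ('n list \<Rightarrow>\<^sub>0 'k) set) list"
    and \<epsilon> \<phi> :: "('n list \<Rightarrow>\<^sub>0 'k) set \<Rightarrow> 'k"
    and t :: "('n list \<Rightarrow>\<^sub>0 'k) set"
    and S :: "('n list \<Rightarrow>\<^sub>0 'k) set \<Rightarrow> ('n list \<Rightarrow>\<^sub>0 'k) set"
  assumes bi_frob: "bi_frobenius (qci q a) \<Delta> \<epsilon> \<phi> t S"
begin

lemma linear_eps: "linear_form R \<epsilon>" and frobenius: "frobenius_form R \<phi>" and linear_phi: "linear_form R \<phi>"
  and t_closed [simp, intro]: "t \<in> carrier R"
  and eps_one: "\<epsilon> \<one>\<^bsub>R\<^esub> = 1"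
  and eps_mult: "x \<in> carrier R \<Longrightarrow> y \<in> carrier R \<Longrightarrow> \<epsilon> (x \<otimes>\<^bsub>R\<^esub> y) = \<epsilon> x * \<epsilon> y"
  and S_one: "S \<one>\<^bsub>R\<^esub> = \<one>\<^bsub>R\<^esub>"
  and S_mult: "x \<in> carrier R \<Longrightarrow> y \<in> carrier R \<Longrightarrow> S (x \<otimes>\<^bsub>R\<^esub> y) = S y \<otimes>\<^bsub>R\<^esub> S x"
  and eps_S: "x \<in> carrier R \<Longrightarrow> \<epsilon> (S x) = \<epsilon> x"
  and Delta_closed: "x \<in> carrier R \<Longrightarrow> set (\<Delta> x) \<subseteq> carrier R \<times> carrier R"
  and S_eq: "x \<in> carrier R \<Longrightarrow>
        S x = sweedler_sum R (\<lambda>t1 t2. \<phi> (t1 \<otimes>\<^bsub>R\<^esub> x) \<odot>\<^bsub>R\<^esub> t2) (\<Delta> t)"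
  and Delta_S: "x \<in> carrier R \<Longrightarrow> tensor2_eq R (\<Delta> (S x)) (map (\<lambda>(x1, x2). (S x2, S x1)) (\<Delta> x))"
  and counit_left: "x \<in> carrier R \<Longrightarrow> sweedler_sum R (\<lambda>x1 x2. \<epsilon> x1 \<odot>\<^bsub>R\<^esub> x2) (\<Delta> x) = x"
  and counit_right: "x \<in> carrier R \<Longrightarrow> sweedler_sum R (\<lambda>x1 x2. \<epsilon> x2 \<odot>\<^bsub>R\<^esub> x1) (\<Delta> x) = x"
proof -
  have coalg: "coalgebra R \<Delta> \<epsilon>"
    and S_eq: "\<forall>x\<in>carrier R. S x = sweedler_sum R (\<lambda>t1 t2. \<phi> (t1 \<otimes>\<^bsub>R\<^esub> x) \<odot>\<^bsub>R\<^esub> t2) (\<Delta> t)"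
    and frob: "frobenius_form R \<phi>" "frobenius_coform R \<Delta> t"
    and eps_one: "\<epsilon> \<one>\<^bsub>R\<^esub> = 1"
    and eps_mult: "\<forall>x\<in>carrier R. \<forall>y\<in>carrier R. \<epsilon> (x \<otimes>\<^bsub>R\<^esub> y) = \<epsilon> x * \<epsilon> y"
    and S_one: "S \<one>\<^bsub>R\<^esub> = \<one>\<^bsub>R\<^esub>"
    and S_mult: "\<forall>x\<in>carrier R. \<forall>y\<in>carrier R. S (x \<otimes>\<^bsub>R\<^esub> y) = S y \<otimes>\<^bsub>R\<^esub> S x"
    and eps_S: "\<forall>x\<in>carrier R. \<epsilon> (S x) = \<epsilon> x"
    and Delta_S: "\<forall>x\<in>carrier R. tensor2_eq R (\<Delta> (S x)) (map (\<lambda>(x1, x2). (S x2, S x1)) (\<Delta> x))"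
    using bi_frob unfolding bi_frobenius_def by - (elim conjE, assumption)+
  show "frobenius_form R \<phi>" "linear_form R \<phi>" "t \<in> carrier R"
    using frob by (simp_all add: frobenius_form_def frobenius_coform_def)
  show "linear_form R \<epsilon>" "x \<in> carrier R \<Longrightarrow> set (\<Delta> x) \<subseteq> carrier R \<times> carrier R"
    "x \<in> carrier R \<Longrightarrow> sweedler_sum R (\<lambda>x1 x2. \<epsilon> x1 \<odot>\<^bsub>R\<^esub> x2) (\<Delta> x) = x"
    "x \<in> carrier R \<Longrightarrow> sweedler_sum R (\<lambda>x1 x2. \<epsilon> x2 \<odot>\<^bsub>R\<^esub> x1) (\<Delta> x) = x"
    using coalg by (simp_all add: coalgebra_def)
  show "S \<one>\<^bsub>R\<^esub> = \<one>\<^bsub>R\<^esub>" "\<epsilon> \<one>\<^bsub>R\<^esub> = 1" by (rule S_one, rule eps_one)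
  show "\<epsilon> (x \<otimes>\<^bsub>R\<^esub> y) = \<epsilon> x * \<epsilon> y" if "x \<in> carrier R" "y \<in> carrier R"
    using eps_mult that by blast
  show "S (x \<otimes>\<^bsub>R\<^esub> y) = S y \<otimes>\<^bsub>R\<^esub> S x" if "x \<in> carrier R" "y \<in> carrier R"
    using S_mult that by blast
  show "\<epsilon> (S x) = \<epsilon> x" if "x \<in> carrier R" using eps_S that by blast
  show "S x = sweedler_sum R (\<lambda>t1 t2. \<phi> (t1 \<otimes>\<^bsub>R\<^esub> x) \<odot>\<^bsub>R\<^esub> t2) (\<Delta> t)" if "x \<in> carrier R"
    by (rule bspec[OF S_eq that])
  show "tensor2_eq R (\<Delta> (S x)) (map (\<lambda>(x1, x2). (S x2, S x1)) (\<Delta> x))" if "x \<in> carrier R"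
    by (rule bspec[OF Delta_S that])
qed

lemma eps_eq: "x \<in> carrier R \<Longrightarrow> \<epsilon> x = coord 0 x"
  by (rule augmentation_eq_coord[OF linear_eps eps_one eps_mult])

lemma S_closed [simp, intro]: "x \<in> carrier R \<Longrightarrow> S x \<in> carrier R"
  unfolding S_eq by (rule sweedler_sum_closed[OF Delta_closed]) auto

text \<open>
  The defining formula of the antipode, tested against a linear form so that no sum in the algebra
  remains.
\<close>

lemma linear_form_S:
  assumes "linear_form R f" "x \<in> carrier R"
  shows "f (S x) = (\<Sum>(t1, t2)\<leftarrow>\<Delta> t. \<phi> (t1 \<otimes>\<^bsub>R\<^esub> x) * f t2)"
proof -
  have "f (S x) = (\<Sum>(t1, t2)\<leftarrow>\<Delta> t. f (\<phi> (t1 \<otimes>\<^bsub>R\<^esub> x) \<odot>\<^bsub>R\<^esub> t2))"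
    unfolding S_eq[OF assms(2)] by (rule linear_form_sweedler_sum[OF assms(1) Delta_closed]) auto
  also have "\<dots> = (\<Sum>(t1, t2)\<leftarrow>\<Delta> t. \<phi> (t1 \<otimes>\<^bsub>R\<^esub> x) * f t2)"
    using Delta_closed[OF t_closed]
    by (intro arg_cong[of _ _ sum_list] map_cong) (auto simp: linear_form_smult[OF assms(1)])
  finally show ?thesis .
qed

lemma linear_form_comp_S:
  assumes "linear_form R f"
  shows "linear_form R (\<lambda>x. f (S x))"
proof -
  interpret R: ring R by (rule ring_R)
  have add: "(\<Sum>(t1, t2)\<leftarrow>s. \<phi> (t1 \<otimes>\<^bsub>R\<^esub> (x \<oplus>\<^bsub>R\<^esub> y)) * f t2) =
     (\<Sum>(t1, t2)\<leftarrow>s. \<phi> (t1 \<otimes>\<^bsub>R\<^esub> x) * f t2) + (\<Sum>(t1, t2)\<leftarrow>s. \<phi> (t1 \<otimes>\<^bsub>R\<^esub> y) * f t2)"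
    if "set s \<subseteq> carrier R \<times> carrier R" "x \<in> carrier R" "y \<in> carrier R" for s x y
    using that by (induction s) (auto simp: R.r_distr linear_form_add[OF linear_phi] algebra_simps)
  have smult: "(\<Sum>(t1, t2)\<leftarrow>s. \<phi> (t1 \<otimes>\<^bsub>R\<^esub> (k \<odot>\<^bsub>R\<^esub> x)) * f t2) =
     k * (\<Sum>(t1, t2)\<leftarrow>s. \<phi> (t1 \<otimes>\<^bsub>R\<^esub> x) * f t2)"
    if "set s \<subseteq> carrier R \<times> carrier R" "x \<in> carrier R" for s k x
    using that by (induction s)
      (auto simp: smult_mult_right linear_form_smult[OF linear_phi] algebra_simps)
  show ?thesis
    unfolding linear_form_def
    by (auto simp: linear_form_S[OF assms] add smult Delta_closed)
qed

lemma S_add: "x \<in> carrier R \<Longrightarrow> y \<in> carrier R \<Longrightarrow> S (x \<oplus>\<^bsub>R\<^esub> y) = S x \<oplus>\<^bsub>R\<^esub> S y"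
  by (rule coord_eqI) (auto simp: coord_add linear_form_add[OF linear_form_comp_S[OF linear_form_coord]])

lemma S_smult: "x \<in> carrier R \<Longrightarrow> S (k \<odot>\<^bsub>R\<^esub> x) = k \<odot>\<^bsub>R\<^esub> S x"
  by (rule coord_eqI) (auto simp: coord_smult linear_form_smult[OF linear_form_comp_S[OF linear_form_coord]])

text \<open>
  Apply \<open>\<epsilon>\<close> to \<open>S x = \<Sum> \<phi>(t\<^sub>1 x) t\<^sub>2\<close> and use \<open>\<epsilon> \<circ> S = \<epsilon>\<close> and the counit law.
\<close>

lemma phi_t:
  assumes "x \<in> carrier R"
  shows "\<phi> (t \<otimes>\<^bsub>R\<^esub> x) = \<epsilon> x"
proof -
  have "\<epsilon> x = (\<Sum>(t1, t2)\<leftarrow>\<Delta> t. \<phi> (t1 \<otimes>\<^bsub>R\<^esub> x) * \<epsilon> t2)"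
    using linear_form_S[OF linear_eps assms] by (simp add: eps_S assms)
  also have "\<dots> = (\<Sum>(t1, t2)\<leftarrow>\<Delta> t. \<phi> ((\<epsilon> t2 \<odot>\<^bsub>R\<^esub> t1) \<otimes>\<^bsub>R\<^esub> x))"
    using Delta_closed[OF t_closed] assms
    by (intro arg_cong[of _ _ sum_list] map_cong)
       (auto simp: smult_mult_left linear_form_smult[OF linear_phi])
  also have "\<dots> = \<phi> (sweedler_sum R (\<lambda>x1 x2. \<epsilon> x2 \<odot>\<^bsub>R\<^esub> x1) (\<Delta> t) \<otimes>\<^bsub>R\<^esub> x)"
    by (rule linear_form_sweedler_sum[OF linear_form_mult_right[OF linear_phi assms] Delta_closed, symmetric])
       auto
  finally show ?thesis by (simp add: counit_right)
qed

text \<open>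
  Evaluating \<open>\<phi>(b \<cdot>)\<close> at the top monomial shows \<open>b\<^sub>0 \<phi>(x\<^bsub>a-1\<^esub>) = 1\<close>, which gives both
  inequations at once.
\<close>

lemma top_form_represented:
  obtains b where "b \<in> carrier R" "\<And>x. x \<in> carrier R \<Longrightarrow> coord topv x = \<phi> (b \<otimes>\<^bsub>R\<^esub> x)"
    "coord 0 b \<noteq> 0" "\<phi> (e topv) \<noteq> 0"
proof -
  obtain b where b: "b \<in> carrier R" "\<And>x. x \<in> carrier R \<Longrightarrow> coord topv x = \<phi> (b \<otimes>\<^bsub>R\<^esub> x)"
    using frobenius linear_form_coord[OF top_V] unfolding frobenius_form_def by blast
  have "1 = coord 0 b * \<phi> (e topv)"
    using b(2)[of "e topv"] by (simp add: linear_form_mult_top[OF linear_phi b(1)] coord_monomial)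
  then show thesis using b by (intro that) auto
qed

lemma phi_top_nonzero: "\<phi> (e topv) \<noteq> 0"
  using top_form_represented by blast

text \<open>
  If \<open>w\<close> is of minimal degree in the support of \<open>t\<close>, then \<open>\<phi>(t x\<^bsub>a-1-w\<^esub>) \<noteq> 0\<close>, while this value is
  \<open>\<epsilon>(x\<^bsub>a-1-w\<^esub>)\<close>. Hence \<open>w = a - 1\<close>, and nothing else is in the support.
\<close>

lemma t_eq: obtains \<tau> where "t = \<tau> \<odot>\<^bsub>R\<^esub> e topv" "\<tau> * \<phi> (e topv) = 1"
proof -
  interpret R: ring R by (rule ring_R)
  have \<phi>t: "\<phi> t = 1"
    using phi_t[of "\<one>\<^bsub>R\<^esub>"] by (simp add: eps_one)
  then have "t \<noteq> \<zero>\<^bsub>R\<^esub>"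
    using linear_form_0[OF linear_phi] by auto
  then obtain w where w: "w \<in> V" "coord w t \<noteq> 0"
    and min: "\<And>v. v \<in> V \<Longrightarrow> deg v < deg w \<Longrightarrow> coord v t = 0"
    using minimal_support[OF t_closed] by blast
  have "coord 0 (e (topv - w)) \<noteq> 0"
    using linear_form_socle_shift[OF linear_phi t_closed w(1) min] w(2) phi_top_nonzero
    unfolding phi_t[OF monomial_closed] eps_eq[OF monomial_closed] by simp
  then have "topv - w = 0"
    by (auto simp: coord_monomial split: if_splits)
  then have "w = topv"
    using add_diff_top[OF w(1)] by simp
  have "t = coord topv t \<odot>\<^bsub>R\<^esub> e topv"
  proof (rule coord_eqI)
    fix v assume v: "v \<in> V"
    have "coord v t = 0" if "v \<noteq> topv"
      using v that min[OF v] deg_strict_mono[of v topv] by (simp add: V_iff \<open>w = topv\<close>)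
    then show "coord v t = coord v (coord topv t \<odot>\<^bsub>R\<^esub> e topv)"
      using v by (auto simp: coord_smult coord_monomial)
  qed auto
  moreover from this have "coord topv t * \<phi> (e topv) = 1"
    using \<phi>t linear_form_smult[OF linear_phi, of "e topv" "coord topv t"] by simp
  ultimately show thesis by (rule that)
qed

text \<open>
  Since \<open>t\<close> lies in the socle, also \<open>\<phi>(x t) = \<epsilon> x\<close>, and \<open>S t = \<Sum> \<epsilon>(t\<^sub>1) t\<^sub>2\<close>.
\<close>

lemma S_t: "S t = t"
proof (rule coord_eqI)
  obtain \<tau> where \<tau>: "t = \<tau> \<odot>\<^bsub>R\<^esub> e topv" "\<tau> * \<phi> (e topv) = 1"
    by (rule t_eq)
  have \<phi>: "\<phi> (x \<otimes>\<^bsub>R\<^esub> t) = \<epsilon> x" if "x \<in> carrier R" for x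
    using that \<tau>(2)
    by (simp add: \<tau>(1) smult_mult_right linear_form_smult[OF linear_phi]
        linear_form_mult_top[OF linear_phi] eps_eq algebra_simps)
  fix v assume v: "v \<in> V"
  have "coord v (S t) = (\<Sum>(t1, t2)\<leftarrow>\<Delta> t. \<phi> (t1 \<otimes>\<^bsub>R\<^esub> t) * coord v t2)"
    by (rule linear_form_S[OF linear_form_coord[OF v] t_closed])
  also have "\<dots> = (\<Sum>(t1, t2)\<leftarrow>\<Delta> t. coord v (\<epsilon> t1 \<odot>\<^bsub>R\<^esub> t2))"
    using Delta_closed[OF t_closed] v
    by (intro arg_cong[of _ _ sum_list] map_cong) (auto simp: \<phi> coord_smult)
  also have "\<dots> = coord v (sweedler_sum R (\<lambda>x1 x2. \<epsilon> x1 \<odot>\<^bsub>R\<^esub> x2) (\<Delta> t))"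
    by (rule linear_form_sweedler_sum[OF linear_form_coord[OF v] Delta_closed, symmetric]) auto
  finally show "coord v (S t) = coord v t" by (simp add: counit_left)
qed auto

lemma S_top: "S (e topv) = e topv"
proof -
  obtain \<tau> where \<tau>: "t = \<tau> \<odot>\<^bsub>R\<^esub> e topv" "\<tau> * \<phi> (e topv) = 1"
    by (rule t_eq)
  then have "\<tau> \<noteq> 0" by auto
  then have "e topv = inverse \<tau> \<odot>\<^bsub>R\<^esub> t"
    by (simp add: \<tau>(1) smult_smult smult_one)
  then show ?thesis by (metis S_smult S_t t_closed)
qed

text \<open>
  \<open>S\<close> fixes the top monomial, which is a multiple of every \<open>x\<^sub>v\<close> with \<open>v \<in> V\<close>.
\<close>

lemma S_monomial_nonzero:
  assumes "v \<in> V"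
  shows "S (e v) \<noteq> \<zero>\<^bsub>R\<^esub>"
proof
  interpret R: ring R by (rule ring_R)
  assume "S (e v) = \<zero>\<^bsub>R\<^esub>"
  then have "S (e v \<otimes>\<^bsub>R\<^esub> e (topv - v)) = \<zero>\<^bsub>R\<^esub>"
    by (simp add: S_mult)
  moreover have "S (e v \<otimes>\<^bsub>R\<^esub> e (topv - v)) = reorder q v (topv - v) \<odot>\<^bsub>R\<^esub> e topv"
    using assms by (simp add: monomial_mult add_diff_top S_smult S_top)
  ultimately have "coord topv (reorder q v (topv - v) \<odot>\<^bsub>R\<^esub> e topv) = 0"
    by (simp add: coord_zero)
  then show False by (simp add: coord_smult coord_monomial)
qed

end

locale permutation_antipode_qci = bi_frobenius_qci q a \<Delta> \<epsilon> \<phi> t S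
  for q :: "'n::{finite,linorder} \<Rightarrow> 'n \<Rightarrow> 'k::field" and a :: "'n \<Rightarrow> nat"
    and \<Delta> :: "('n list \<Rightarrow>\<^sub>0 'k) set \<Rightarrow> (('n list \<Rightarrow>\<^sub>0 'k) set \<times> ('n list \<Rightarrow>\<^sub>0 'k) set) list"
    and \<epsilon> \<phi> :: "('n list \<Rightarrow>\<^sub>0 'k) set \<Rightarrow> 'k"
    and t :: "('n list \<Rightarrow>\<^sub>0 'k) set"
    and S :: "('n list \<Rightarrow>\<^sub>0 'k) set \<Rightarrow> ('n list \<Rightarrow>\<^sub>0 'k) set" +
  fixes \<pi> :: "('n \<Rightarrow> nat) \<Rightarrow> 'n \<Rightarrow> nat" and c :: "('n \<Rightarrow> nat) \<Rightarrow> 'k"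
  assumes perm: "permutation_antipode q a S \<pi> c"
begin

lemma pi_permutes: "\<pi> permutes V"
  and S_monomial: "v \<in> V \<Longrightarrow> S (e v) = c v \<odot>\<^bsub>R\<^esub> e (\<pi> v)"
  using perm by (auto simp: permutation_antipode_def)

lemma pi_V [simp]: "\<pi> v \<in> V \<longleftrightarrow> v \<in> V"
  by (rule permutes_in_image[OF pi_permutes])

lemma pi_eq_iff [simp]: "\<pi> u = \<pi> v \<longleftrightarrow> u = v"
  using permutes_inj[OF pi_permutes] by (auto dest: injD)

lemma c_nonzero: "v \<in> V \<Longrightarrow> c v \<noteq> 0"
  using S_monomial_nonzero[of v] by (auto simp: S_monomial smult_zero)

lemma coord_S:
  assumes "v \<in> V" "x \<in> carrier R"
  shows "coord (\<pi> v) (S x) = c v * coord v x"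
proof -
  have "coord (\<pi> v) (S x) = (\<Sum>u\<in>V. coord u x * coord (\<pi> v) (S (e u)))"
    using assms by (intro linear_form_expand linear_form_comp_S linear_form_coord) auto
  also have "\<dots> = (\<Sum>u\<in>V. if u = v then c v * coord v x else 0)"
    using assms by (intro sum.cong) (auto simp: S_monomial coord_smult coord_monomial)
  finally show ?thesis using assms by (simp add: sum.delta)
qed

lemma S_inject:
  assumes "x \<in> carrier R" "y \<in> carrier R" "S x = S y"
  shows "x = y"
proof (rule coord_eqI)
  fix v assume v: "v \<in> V"
  have "c v * coord v x = c v * coord v y"
    unfolding coord_S[OF v assms(1), symmetric] coord_S[OF v assms(2), symmetric] assms(3) ..
  then show "coord v x = coord v y" using c_nonzero[OF v] by auto
qed (use assms in auto)

lemma pi_top: "\<pi> topv = topv"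
proof -
  have "coord topv (c topv \<odot>\<^bsub>R\<^esub> e (\<pi> topv)) = 1"
    using S_monomial[OF top_V] coord_monomial[OF top_V, of topv] by (simp add: S_top)
  then show ?thesis
    by (simp add: coord_smult coord_monomial split: if_splits)
qed

text \<open>
  The element \<open>x' = \<Sum> \<phi>(S t\<^sub>2 x) t\<^sub>1\<close> has the same image under \<open>S\<close> as \<open>x\<close>, because
  \<open>\<Sum> S t\<^sub>2 \<otimes> S t\<^sub>1 = \<Delta>(S t) = \<Delta> t\<close>. So \<open>x' = x\<close>, and evaluating \<open>\<phi>(x' z)\<close> produces \<open>S z\<close> by its
  defining formula, under a second \<open>S\<close>.
\<close>

lemma phi_nakayama:
  assumes "x \<in> carrier R" "z \<in> carrier R"
  shows "\<phi> (x \<otimes>\<^bsub>R\<^esub> z) = \<phi> (S (S z) \<otimes>\<^bsub>R\<^esub> x)"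
proof -
  note \<Delta>t = Delta_closed[OF t_closed]
  define x' where "x' = sweedler_sum R (\<lambda>t1 t2. \<phi> (S t2 \<otimes>\<^bsub>R\<^esub> x) \<odot>\<^bsub>R\<^esub> t1) (\<Delta> t)"
  have x': "x' \<in> carrier R"
    unfolding x'_def by (rule sweedler_sum_closed[OF \<Delta>t]) auto
  have f_x': "f x' = (\<Sum>(t1, t2)\<leftarrow>\<Delta> t. \<phi> (S t2 \<otimes>\<^bsub>R\<^esub> x) * f t1)" if "linear_form R f" for f
  proof -
    have "f x' = (\<Sum>(t1, t2)\<leftarrow>\<Delta> t. f (\<phi> (S t2 \<otimes>\<^bsub>R\<^esub> x) \<odot>\<^bsub>R\<^esub> t1))"
      unfolding x'_def by (rule linear_form_sweedler_sum[OF that \<Delta>t]) auto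
    also have "\<dots> = (\<Sum>(t1, t2)\<leftarrow>\<Delta> t. \<phi> (S t2 \<otimes>\<^bsub>R\<^esub> x) * f t1)"
      using \<Delta>t by (intro arg_cong[of _ _ sum_list] map_cong) (auto simp: linear_form_smult[OF that])
    finally show ?thesis .
  qed
  have "S x' = S x"
  proof (rule coord_eqI)
    fix v assume v: "v \<in> V"
    let ?\<beta> = "\<lambda>y z. \<phi> (y \<otimes>\<^bsub>R\<^esub> x) * coord v z"
    have \<beta>: "bilinear_form R ?\<beta>"
      using linear_form_mult_right[OF linear_phi assms(1)] linear_form_coord[OF v]
      unfolding bilinear_form_def linear_form_def by (auto simp: algebra_simps)
    have "coord v (S x) = (\<Sum>(t1, t2)\<leftarrow>\<Delta> (S t). ?\<beta> t1 t2)"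
      using linear_form_S[OF linear_form_coord[OF v] assms(1)] by (simp add: S_t)
    also have "\<dots> = (\<Sum>(t1, t2)\<leftarrow>map (\<lambda>(x1, x2). (S x2, S x1)) (\<Delta> t). ?\<beta> t1 t2)"
      using Delta_S[OF t_closed] \<beta> unfolding tensor2_eq_def by blast
    also have "\<dots> = (\<Sum>(t1, t2)\<leftarrow>\<Delta> t. \<phi> (S t2 \<otimes>\<^bsub>R\<^esub> x) * coord v (S t1))"
      by (simp add: case_prod_unfold comp_def)
    also have "\<dots> = coord v (S x')"
      by (rule f_x'[OF linear_form_comp_S[OF linear_form_coord[OF v]], symmetric])
    finally show "coord v (S x') = coord v (S x)" ..
  qed (use x' assms in auto)
  then have "x' = x" using S_inject x' assms(1) by blast
  then have "\<phi> (x \<otimes>\<^bsub>R\<^esub> z) = (\<Sum>(t1, t2)\<leftarrow>\<Delta> t. \<phi> (S t2 \<otimes>\<^bsub>R\<^esub> x) * \<phi> (t1 \<otimes>\<^bsub>R\<^esub> z))"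
    using f_x'[OF linear_form_mult_right[OF linear_phi assms(2)]] by simp
  also have "\<dots> = (\<Sum>(t1, t2)\<leftarrow>\<Delta> t. \<phi> (t1 \<otimes>\<^bsub>R\<^esub> z) * \<phi> (S t2 \<otimes>\<^bsub>R\<^esub> x))"
    by (simp add: mult.commute)
  also have "\<dots> = \<phi> (S (S z) \<otimes>\<^bsub>R\<^esub> x)"
    by (rule linear_form_S[OF linear_form_comp_S[OF linear_form_mult_right[OF linear_phi assms(1)]] assms(2), symmetric])
  finally show ?thesis .
qed

abbreviation "h v \<equiv> hcoef q a (\<lambda>i. int (v i))"

lemma h_nonzero: "v \<in> V \<Longrightarrow> h v \<noteq> 0"
  by (simp add: hcoef_eq)

text \<open>
  Both \<open>\<phi>\<close> and the dual form \<open>\<phi>(b \<cdot>)\<close> of the top monomial have explicit Nakayama automorphisms, and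
  comparing them gives \<open>S\<^sup>2(x\<^sub>v) b = h\<^sub>v b x\<^sub>v\<close>. The left side is divisible by \<open>x\<^bsub>\<pi>\<pi>v\<^esub>\<close> and contains it
  with coefficient \<open>c\<^sub>v c\<^bsub>\<pi>v\<^esub> b\<^sub>0 \<noteq> 0\<close>; the right side is divisible by \<open>x\<^sub>v\<close> and contains it with
  coefficient \<open>h\<^sub>v b\<^sub>0 \<noteq> 0\<close>. So the two exponents bound each other.
\<close>

lemma
  assumes "v \<in> V"
  shows pi_pi_V: "\<pi> (\<pi> v) = v" and c_mult_c: "c v * c (\<pi> v) = h v"
proof -
  interpret R: ring R by (rule ring_R)
  obtain b where b: "b \<in> carrier R" "\<And>x. x \<in> carrier R \<Longrightarrow> coord topv x = \<phi> (b \<otimes>\<^bsub>R\<^esub> x)"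
    "coord 0 b \<noteq> 0"
    using top_form_represented by blast
  let ?u = "\<pi> (\<pi> v)" and ?C = "c v * c (\<pi> v)"
  have SS: "S (S (e v)) = ?C \<odot>\<^bsub>R\<^esub> e ?u"
    using assms by (simp add: S_monomial S_smult smult_smult)
  have "S (S (e v)) \<otimes>\<^bsub>R\<^esub> b = h v \<odot>\<^bsub>R\<^esub> (b \<otimes>\<^bsub>R\<^esub> e v)"
  proof (rule left_nondegenerate[OF linear_phi phi_top_nonzero])
    fix x assume x: "x \<in> carrier R"
    have "\<phi> (S (S (e v)) \<otimes>\<^bsub>R\<^esub> b \<otimes>\<^bsub>R\<^esub> x) = \<phi> (S (S (e v)) \<otimes>\<^bsub>R\<^esub> (b \<otimes>\<^bsub>R\<^esub> x))"
      using b x by (simp add: R.m_assoc)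
    also have "\<dots> = \<phi> (b \<otimes>\<^bsub>R\<^esub> x \<otimes>\<^bsub>R\<^esub> e v)"
      using b x by (simp add: phi_nakayama[of "b \<otimes>\<^bsub>R\<^esub> x" "e v"])
    also have "\<dots> = coord topv (x \<otimes>\<^bsub>R\<^esub> e v)"
      using b x by (simp add: R.m_assoc)
    also have "\<dots> = h v * \<phi> (b \<otimes>\<^bsub>R\<^esub> (e v \<otimes>\<^bsub>R\<^esub> x))"
      using top_form_nakayama[OF assms x] b(2)[of "e v \<otimes>\<^bsub>R\<^esub> x"] x by simp
    also have "\<dots> = \<phi> (h v \<odot>\<^bsub>R\<^esub> (b \<otimes>\<^bsub>R\<^esub> e v) \<otimes>\<^bsub>R\<^esub> x)"
      using b x by (simp add: smult_mult_left linear_form_smult[OF linear_phi] R.m_assoc)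
    finally show "\<phi> (S (S (e v)) \<otimes>\<^bsub>R\<^esub> b \<otimes>\<^bsub>R\<^esub> x) = \<phi> (h v \<odot>\<^bsub>R\<^esub> (b \<otimes>\<^bsub>R\<^esub> e v) \<otimes>\<^bsub>R\<^esub> x)" .
  qed (use b in auto)
  then have eq: "?C * coord w (e ?u \<otimes>\<^bsub>R\<^esub> b) = h v * coord w (b \<otimes>\<^bsub>R\<^esub> e v)" if "w \<in> V" for w
    using b(1) that by (simp add: SS smult_mult_left flip: coord_smult)
  \<comment> \<open>The coefficient of \<open>x\<^sub>v\<close> on the right is \<open>h\<^sub>v b\<^sub>0 \<noteq> 0\<close>, so \<open>x\<^sub>v\<close> occurs in \<open>x\<^sub>u b\<close>.\<close>
  have "?u \<le> v"
    using eq[OF assms] assms b(1,3) h_nonzero[OF assms]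
    by (auto simp: coord_monomial_mult coord_mult_monomial split: if_splits)
  \<comment> \<open>The coefficient of \<open>x\<^sub>u\<close> on the left is nonzero, so \<open>x\<^sub>u\<close> occurs in \<open>b x\<^sub>v\<close>.\<close>
  moreover have "v \<le> ?u"
    using eq[of ?u] assms b(1,3) c_nonzero[of v] c_nonzero[of "\<pi> v"]
    by (auto simp: coord_monomial_mult coord_mult_monomial split: if_splits)
  ultimately show u: "?u = v" by (rule antisym)
  show "?C = h v"
    using eq[OF assms] assms b(1,3) by (simp add: u coord_monomial_mult coord_mult_monomial)
qed

end

section \<open>The permutation of the generators\<close>

lemma perm_act_add: "perm_act \<sigma> (u + v) = perm_act \<sigma> u + perm_act \<sigma> v"
  by (simp add: perm_act_def fun_eq_iff)

lemma perm_act_zero: "perm_act \<sigma> 0 = 0"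
  by (simp add: perm_act_def fun_eq_iff)

lemma perm_act_unit: "bij \<sigma> \<Longrightarrow> perm_act \<sigma> (unit_index i) = unit_index (\<sigma> i)"
  by (simp add: perm_act_def unit_index_def fun_eq_iff) (metis bij_inv_eq_iff)

lemma perm_act_apply: "bij \<sigma> \<Longrightarrow> perm_act \<sigma> v (\<sigma> i) = v i"
  by (simp add: perm_act_def bij_is_inj)

lemma unit_index_inject: "unit_index i = (unit_index j :: 'n \<Rightarrow> nat) \<Longrightarrow> i = j"
  by (metis unit_index_def zero_neq_one)

lemma unit_index_nonzero: "unit_index i \<noteq> (0 :: 'n \<Rightarrow> nat)"
  by (metis unit_index_def zero_fun_apply zero_neq_one)

lemma of_nat_unit_index: "(\<lambda>j. int (unit_index i j)) = unit_index i"
  by (simp add: unit_index_def fun_eq_iff)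

text \<open>
  Expanding both arguments into unit vectors; only a bijection makes the pairs of images run through all
  pairs of indices.
\<close>

lemma reorder_perm_act:
  assumes "bij \<sigma>"
  shows "reorder q (perm_act \<sigma> u) (perm_act \<sigma> v) =
    (\<Prod>j\<in>UNIV. \<Prod>k\<in>UNIV. reorder q (unit_index (\<sigma> k)) (unit_index (\<sigma> j)) ^ (u k * v j))"
proof -
  let ?f = "\<lambda>(i, l). if i < l then q i l ^ (perm_act \<sigma> u l * perm_act \<sigma> v i) else 1"
  have "bij (map_prod \<sigma> \<sigma>)"
    using assms by (metis bij_betw_map_prod UNIV_Times_UNIV)
  have "reorder q (perm_act \<sigma> u) (perm_act \<sigma> v) = (\<Prod>p\<in>UNIV. ?f p)"
    unfolding reorder_def by (rule prod.mono_neutral_cong_left) (auto split: if_splits)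
  also have "\<dots> = (\<Prod>p\<in>UNIV. ?f (map_prod \<sigma> \<sigma> p))"
    by (rule prod.reindex_bij_betw[OF \<open>bij (map_prod \<sigma> \<sigma>)\<close>, symmetric])
  also have "\<dots> = (\<Prod>(j, k)\<in>UNIV \<times> UNIV.
      reorder q (unit_index (\<sigma> k)) (unit_index (\<sigma> j)) ^ (u k * v j))"
    by (rule prod.cong) (auto simp: reorder_unit_unit perm_act_apply[OF assms])
  also have "\<dots> = (\<Prod>j\<in>UNIV. \<Prod>k\<in>UNIV.
      reorder q (unit_index (\<sigma> k)) (unit_index (\<sigma> j)) ^ (u k * v j))"
    by (rule prod.cartesian_product[symmetric])
  finally show ?thesis .
qed

context quantum_ci
begin

lemma unit_V [simp]: "unit_index i \<in> V"
  unfolding basis_index_def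
proof (intro CollectI allI)
  fix j
  have "1 \<le> a j - 1" using a_ge_2[of j] by linarith
  then show "unit_index i j \<le> a j - 1" by (auto simp: unit_index_def)
qed

lemma V_summands:
  assumes "u + v \<in> V"
  shows "u \<in> V" "v \<in> V"
  by (rule V_downward[OF assms], simp add: le_fun_def)+

text \<open>
  Monomials are built up one generator at a time without leaving \<open>V\<close>.
\<close>

lemma V_induct [consumes 1, case_names zero add]:
  assumes "v \<in> V" "P 0" "\<And>i v. unit_index i + v \<in> V \<Longrightarrow> P v \<Longrightarrow> P (unit_index i + v)"
  shows "P v"
  using assms(1)
proof (induction "deg v" arbitrary: v rule: less_induct)
  case less
  show ?case
  proof (cases "v = 0")
    case False
    then obtain i where i: "v i \<noteq> 0" by (auto simp: fun_eq_iff)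
    have le: "unit_index i \<le> v"
      using i by (auto simp: le_fun_def unit_index_def)
    then have v: "unit_index i + (v - unit_index i) = v"
      using exponent_add_eq_iff by blast
    have "(v - unit_index i) i \<noteq> v i"
      using i by (simp add: unit_index_def)
    then have ne: "v - unit_index i \<noteq> v" by metis
    have "v - unit_index i \<le> v" by (simp add: le_fun_def)
    then have "deg (v - unit_index i) < deg v" using ne by (rule deg_strict_mono)
    moreover have "v - unit_index i \<in> V"
      by (rule V_downward[OF less.prems]) (simp add: le_fun_def)
    ultimately have "P (v - unit_index i)" by (rule less.hyps)
    then show ?thesis
      using assms(3)[of i "v - unit_index i"] less.prems by (simp only: v)
  qed (use assms(2) in simp)
qed

lemma deg_add: "deg (u + v) = deg u + deg v"
  by (simp add: sum.distrib)

lemma deg_eq_0_iff: "deg v = 0 \<longleftrightarrow> v = 0"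
  by (auto simp: fun_eq_iff)

end

context permutation_antipode_qci
begin

text \<open>
  Expand \<open>S(x\<^sub>u x\<^sub>v) = S(x\<^sub>v) S(x\<^sub>u)\<close>. The left side is a nonzero multiple of \<open>x\<^bsub>\<pi>(u+v)\<^esub>\<close>, so the right
  side is one too.
\<close>

lemma
  assumes "u + v \<in> V"
  shows pi_add: "\<pi> (u + v) = \<pi> u + \<pi> v"
    and c_add: "c (u + v) * reorder q u v = c u * c v * reorder q (\<pi> v) (\<pi> u)"
proof -
  note uv = V_summands[OF assms]
  have "S (e u \<otimes>\<^bsub>R\<^esub> e v) = (reorder q u v * c (u + v)) \<odot>\<^bsub>R\<^esub> e (\<pi> (u + v))"
    using assms by (simp add: monomial_mult S_smult S_monomial smult_smult)
  moreover have "S (e u \<otimes>\<^bsub>R\<^esub> e v) = (c u * c v * reorder q (\<pi> v) (\<pi> u)) \<odot>\<^bsub>R\<^esub> e (\<pi> v + \<pi> u)"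
  proof -
    have "S (e u \<otimes>\<^bsub>R\<^esub> e v) = S (e v) \<otimes>\<^bsub>R\<^esub> S (e u)"
      by (rule S_mult) auto
    also have "\<dots> = (c u * c v * reorder q (\<pi> v) (\<pi> u)) \<odot>\<^bsub>R\<^esub> e (\<pi> v + \<pi> u)"
      using uv by (simp add: S_monomial smult_mult_left smult_mult_right smult_smult
          monomial_mult mult_ac)
    finally show ?thesis .
  qed
  ultimately have "coord (\<pi> (u + v)) ((reorder q u v * c (u + v)) \<odot>\<^bsub>R\<^esub> e (\<pi> (u + v))) =
      coord (\<pi> (u + v)) ((c u * c v * reorder q (\<pi> v) (\<pi> u)) \<odot>\<^bsub>R\<^esub> e (\<pi> v + \<pi> u))"
    by simp
  then have "reorder q u v * c (u + v) =
      (if \<pi> v + \<pi> u = \<pi> (u + v) then c u * c v * reorder q (\<pi> v) (\<pi> u) else 0)"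
    using assms by (simp add: coord_smult coord_monomial)
  with c_nonzero[OF assms]
  show "\<pi> (u + v) = \<pi> u + \<pi> v" "c (u + v) * reorder q u v = c u * c v * reorder q (\<pi> v) (\<pi> u)"
    by (auto simp: add.commute mult.commute split: if_splits)
qed

lemma pi_zero: "\<pi> 0 = 0"
  using pi_add[of 0 0] by (metis add_cancel_left_left add_0 zero_V)

text \<open>
  By additivity it suffices that \<open>\<pi>\<close> maps no unit vector to \<open>0 = \<pi> 0\<close>.
\<close>

lemma deg_le_deg_pi: "v \<in> V \<Longrightarrow> deg v \<le> deg (\<pi> v)"
proof (induction rule: V_induct)
  case zero
  show ?case by (simp add: pi_zero)
next
  case (add i v)
  have "\<pi> (unit_index i) \<noteq> \<pi> 0"
    using unit_index_nonzero by (metis pi_eq_iff)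
  then have "deg (\<pi> (unit_index i)) \<noteq> 0"
    using deg_eq_0_iff pi_zero by metis
  moreover have "deg (unit_index i) = 1"
    by (simp add: unit_index_def)
  ultimately show ?case
    using add.IH unfolding pi_add[OF add.hyps] deg_add by linarith
qed

lemma deg_pi:
  assumes "v \<in> V" 
  shows "deg (\<pi> v) = deg v"
  using deg_le_deg_pi[OF assms] deg_le_deg_pi[of "\<pi> v"] pi_pi_V[OF assms] assms by simp

definition \<sigma> :: "'n \<Rightarrow> 'n" where
  "\<sigma> i = (SOME j. \<pi> (unit_index i) = unit_index j)"

lemma pi_unit: "\<pi> (unit_index i) = unit_index (\<sigma> i)"
  unfolding \<sigma>_def
proof (rule someI_ex)
  have "deg (\<pi> (unit_index i)) = 1"
    by (simp add: deg_pi) (simp add: unit_index_def)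
  then obtain j where "\<pi> (unit_index i) j = 1" "\<And>k. j \<noteq> k \<Longrightarrow> \<pi> (unit_index i) k = 0"
    unfolding sum_eq_1_iff[OF finite_UNIV] by blast
  then have "\<pi> (unit_index i) = unit_index j"
    by (auto simp: fun_eq_iff unit_index_def)
  then show "\<exists>j. \<pi> (unit_index i) = unit_index j" ..
qed

lemma bij_sigma: "bij \<sigma>"
proof -
  have "inj \<sigma>"
    by (rule injI) (metis pi_unit pi_eq_iff unit_index_inject)
  then show ?thesis
    by (simp add: bij_def finite_UNIV_inj_surj)
qed

lemma pi_eq_perm_act: "v \<in> V \<Longrightarrow> \<pi> v = perm_act \<sigma> v"
proof (induction rule: V_induct)
  case zero
  show ?case by (simp only: pi_zero perm_act_zero)
next
  case (add i v)
  then show ?case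
    by (simp only: pi_add perm_act_add pi_unit perm_act_unit[OF bij_sigma])
qed

text \<open>
  Decomposing \<open>e\<^sub>i + e\<^sub>j\<close> in both orders eliminates the scalars \<open>c\<close>. What remains only involves
  \<open>q\<^sub>i\<^sub>j\<close>, \<open>q\<^bsub>\<sigma>i,\<sigma>j\<^esub>\<close> and their inverses, arranged according to which of \<open>\<sigma> i\<close>, \<open>\<sigma> j\<close> is smaller.
\<close>

lemma q_sigma: "q (\<sigma> i) (\<sigma> j) = q j i"
proof (cases "i = j")
  case False
  then have V: "unit_index i + unit_index j \<in> V"
    unfolding basis_index_def
  proof (intro CollectI allI)
    fix k
    have "1 \<le> a k - 1" using a_ge_2[of k] by linarith
    then show "(unit_index i + unit_index j) k \<le> a k - 1"
      using False by (auto simp: unit_index_def)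
  qed
  let ?r = "reorder q" and ?u = "unit_index :: 'n \<Rightarrow> 'n \<Rightarrow> nat"
  let ?c = "c (?u i + ?u j)" and ?d = "c (?u i) * c (?u j)"
  have nz: "?c \<noteq> 0" "?d \<noteq> 0"
    using V c_nonzero by simp_all
  have com: "?u j + ?u i = ?u i + ?u j" by (rule add.commute)
  have 1: "?c * ?r (?u i) (?u j) = ?d * ?r (?u (\<sigma> j)) (?u (\<sigma> i))"
    using c_add[OF V] by (simp only: pi_unit)
  have 2: "?c * ?r (?u j) (?u i) = ?d * ?r (?u (\<sigma> i)) (?u (\<sigma> j))"
    using c_add[of "?u j" "?u i"] V by (simp only: com pi_unit mult.commute[of "c (?u j)"] simp_thms)
  have "(?c * ?r (?u i) (?u j)) * (?d * ?r (?u (\<sigma> i)) (?u (\<sigma> j))) =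
      (?d * ?r (?u (\<sigma> j)) (?u (\<sigma> i))) * (?c * ?r (?u j) (?u i))"
    by (simp only: 1 2)
  then have "(?c * ?d) * (?r (?u i) (?u j) * ?r (?u (\<sigma> i)) (?u (\<sigma> j))) =
      (?c * ?d) * (?r (?u j) (?u i) * ?r (?u (\<sigma> j)) (?u (\<sigma> i)))"
    by (simp only: mult_ac)
  then have "?r (?u i) (?u j) * ?r (?u (\<sigma> i)) (?u (\<sigma> j)) =
      ?r (?u j) (?u i) * ?r (?u (\<sigma> j)) (?u (\<sigma> i))"
    using nz by (simp only: mult_cancel_left mult_eq_0_iff simp_thms)
  then have eq: "(if j < i then q j i else 1) * (if \<sigma> j < \<sigma> i then q (\<sigma> j) (\<sigma> i) else 1) =
      (if i < j then q i j else 1) * (if \<sigma> i < \<sigma> j then q (\<sigma> i) (\<sigma> j) else 1)"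
    by (simp only: reorder_unit_unit)
  have inv: "z = q y x" if "q x y * z = 1" for x y z
    using that by (metis inverse_unique q_inv)
  have flip: "q y x = q y' x'" if "q x y = q x' y'" for x y x' y'
    using that by (metis inverse_unique q_inv)
  have "\<sigma> i \<noteq> \<sigma> j"
    using False bij_sigma by (metis bij_pointE)
  with False consider "i < j" "\<sigma> i < \<sigma> j" | "i < j" "\<sigma> j < \<sigma> i"
    | "j < i" "\<sigma> i < \<sigma> j" | "j < i" "\<sigma> j < \<sigma> i"
    by (metis linorder_neqE)
  then show ?thesis
  proof cases
    case 1
    then have "q i j * q (\<sigma> i) (\<sigma> j) = 1" using eq by (auto split: if_splits)
    then show ?thesis by (rule inv)
  next
    case 2
    then have "q (\<sigma> j) (\<sigma> i) = q i j" using eq by (auto split: if_splits)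
    then show ?thesis by (rule flip)
  next
    case 3
    then show ?thesis using eq by (auto split: if_splits)
  next
    case 4
    then have "q (\<sigma> j) (\<sigma> i) * q j i = 1" using eq by (auto simp: mult.commute split: if_splits)
    then show ?thesis by (rule inv[symmetric])
  qed
qed simp

lemma compatible_sigma: "compatible_perm q a \<sigma>"
proof -
  have "a (\<sigma> i) = a i" for i
  proof -
    have "topv (\<sigma> i) = topv i"
      using perm_act_apply[OF bij_sigma, of topv i] pi_eq_perm_act[OF top_V] pi_top by simp
    then show ?thesis
      using a_ge_2[of i] a_ge_2[of "\<sigma> i"] by (simp add: top_index_def)
  qed
  then show ?thesis
    by (simp add: compatible_perm_def bij_sigma q_sigma)
qed

section \<open>The square of the antipode\<close>

lemma h_pi:
  assumes "v \<in> V"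
  shows "h (\<pi> v) = h v"
  using c_mult_c[OF assms] c_mult_c[of "\<pi> v"] pi_pi_V[OF assms] assms by (simp add: mult.commute)

text \<open>
  The relation \<open>c_add\<close> for \<open>v + (a - 1 - v)\<close> and for \<open>(a - 1 - v) + v\<close> has the same scalars \<open>c\<close>; the
  quotient of the two instances is \<open>h\<^sub>v = h\<^bsub>\<pi>v\<^esub>\<^sup>-\<^sup>1\<close>.
\<close>

lemma h_square:
  assumes "v \<in> V"
  shows "h v * h v = 1"
proof -
  let ?u = "topv - v"
  have uv: "v + ?u = topv" by (rule add_diff_top[OF assms])
  then have vu: "?u + v = topv" by (simp only: add.commute)
  have "\<pi> v + \<pi> ?u = topv"
    using pi_add[of v ?u] by (simp add: uv pi_top)
  then have \<pi>u: "\<pi> ?u = topv - \<pi> v"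
    using exponent_add_eq_iff by blast
  let ?d = "c v * c ?u"
  have "?u \<in> V" using V_summands[of v ?u] uv by simp
  then have nz: "?d \<noteq> 0" "c topv \<noteq> 0" using assms c_nonzero by simp_all
  have 1: "c topv * reorder q v ?u = ?d * reorder q (\<pi> ?u) (\<pi> v)"
    using c_add[of v ?u] by (simp add: uv)
  have 2: "c topv * reorder q ?u v = ?d * reorder q (\<pi> v) (\<pi> ?u)"
    using c_add[of ?u v] by (simp add: vu mult_ac)
  have "h v = reorder q ?u v / reorder q v ?u"
    by (rule hcoef_eq[OF assms])
  also have "\<dots> = (c topv * reorder q ?u v) / (c topv * reorder q v ?u)"
    using nz by simp
  also have "\<dots> = reorder q (\<pi> v) (\<pi> ?u) / reorder q (\<pi> ?u) (\<pi> v)"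
    unfolding 1 2 using nz by simp
  also have "\<dots> = inverse (h (\<pi> v))"
    using assms by (simp add: hcoef_eq \<pi>u)
  finally have "h v * h (\<pi> v) = 1"
    using h_nonzero[of "\<pi> v"] assms by simp
  then show ?thesis by (simp only: h_pi[OF assms])
qed

lemma S_S_monomial: "v \<in> V \<Longrightarrow> S (S (e v)) = h v \<odot>\<^bsub>R\<^esub> e v"
  by (simp add: S_monomial S_smult smult_smult c_mult_c pi_pi_V)

lemma coord_S_S:
  assumes "v \<in> V" "x \<in> carrier R"
  shows "coord v (S (S x)) = h v * coord v x"
proof -
  have "coord v (S (S x)) = coord (\<pi> (\<pi> v)) (S (S x))"
    by (simp only: pi_pi_V[OF assms(1)])
  also have "\<dots> = c (\<pi> v) * (c v * coord v x)"
    using assms by (simp add: coord_S)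
  finally show ?thesis
    by (simp add: mult_ac flip: c_mult_c[OF assms(1)])
qed

lemma S_fourth:
  assumes "x \<in> carrier R"
  shows "S (S (S (S x))) = x"
proof (rule coord_eqI)
  fix v assume v: "v \<in> V"
  show "coord v (S (S (S (S x)))) = coord v x"
    using v assms h_square[OF v] by (simp add: coord_S_S flip: mult.assoc)
qed (use assms in auto)

lemma linear_endo_S: "linear_endo R S"
  by (auto simp: linear_endo_def S_add S_smult)

lemma S_S_nakayama: "canonical_nakayama q a (S \<circ> S)"
proof -
  have endo: "linear_endo R (S \<circ> S)"
    by (auto simp: linear_endo_def S_add S_smult)
  have "S \<circ> S \<in> ring_iso R R"
  proof (rule ring_iso_memI)
    show "bij_betw (S \<circ> S) (carrier R) (carrier R)"
      by (rule bij_betwI[of _ _ _ "S \<circ> S"]) (auto simp: S_fourth)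
  qed (auto simp: S_mult S_add S_one)
  moreover have "coord topv (x \<otimes>\<^bsub>R\<^esub> y) = coord topv (S (S y) \<otimes>\<^bsub>R\<^esub> x)"
    if "x \<in> carrier R" "y \<in> carrier R" for x y
  proof -
    have "coord topv (x \<otimes>\<^bsub>R\<^esub> y) = (\<Sum>v\<in>V. coord v y * coord topv (x \<otimes>\<^bsub>R\<^esub> e v))"
      by (rule linear_form_expand[OF linear_form_mult_left[OF linear_form_coord[OF top_V] that(1)] that(2)])
    also have "\<dots> = (\<Sum>v\<in>V. coord v y * coord topv (S (S (e v)) \<otimes>\<^bsub>R\<^esub> x))"
      using that by (intro sum.cong)
        (simp_all add: top_form_nakayama S_S_monomial smult_mult_left coord_smult)
    also have "\<dots> = coord topv (S (S y) \<otimes>\<^bsub>R\<^esub> x)"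
      by (rule linear_form_expand[OF linear_form_comp_S[OF linear_form_comp_S[OF
            linear_form_mult_right[OF linear_form_coord[OF top_V] that(1)]]] that(2), symmetric])
    finally show ?thesis .
  qed
  ultimately have "nakayama_automorphism R (coord topv) (S \<circ> S)"
    using endo by (simp add: nakayama_automorphism_def)
  moreover have "dual_basis_form q a topv (coord topv)"
    by (simp add: dual_basis_form_def linear_form_coord coord_monomial)
  ultimately show ?thesis
    by (auto simp: canonical_nakayama_def S_S_monomial)
qed

lemma graded_S: "graded_map q a S"
  unfolding graded_map_def
proof (intro conjI ballI linear_endo_S)
  fix v assume v: "v \<in> V"
  interpret R: ring R by (rule ring_R)
  let ?U = "{u \<in> V. deg u = deg v}" and ?c = "\<lambda>u. if u = \<pi> v then c v else 0"
  have "S (e v) = (\<Oplus>\<^bsub>R\<^esub>u\<in>?U. if \<pi> v = u then c v \<odot>\<^bsub>R\<^esub> e u else \<zero>\<^bsub>R\<^esub>)"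
    using v by (subst R.add.finprod_singleton) (auto simp: deg_pi S_monomial)
  also have "\<dots> = (\<Oplus>\<^bsub>R\<^esub>u\<in>?U. ?c u \<odot>\<^bsub>R\<^esub> e u)"
    by (rule R.add.finprod_cong') (auto simp: smult_zero)
  finally show "\<exists>c'. S (e v) = (\<Oplus>\<^bsub>R\<^esub>u\<in>?U. c' u \<odot>\<^bsub>R\<^esub> e u)"
    by (rule exI[of _ ?c])
qed

section \<open>The coefficient of the top monomial\<close>

abbreviation "d i \<equiv> c (unit_index i)"

lemma c_zero: "c 0 = 1"
proof -
  have "c 0 * c 0 = c 0"
    using c_add[of 0 0] by (simp add: pi_zero del: zero_fun_apply)
  then show ?thesis
    using c_nonzero[OF zero_V] by simp
qed

lemma c_multiple_unit:
  "n \<le> topv i \<Longrightarrow> c (\<lambda>j. n * unit_index i j) = d i ^ n"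
proof (induction n)
  case 0
  have "(\<lambda>j. 0 * unit_index i j) = (0 :: 'n \<Rightarrow> nat)" by (simp add: fun_eq_iff)
  then show ?case by (simp only: c_zero power_0)
next
  case (Suc n)
  let ?n = "\<lambda>j. n * unit_index i j"
  have eq: "unit_index i + ?n = (\<lambda>j. Suc n * unit_index i j)"
    by (simp add: fun_eq_iff)
  have V: "unit_index i + ?n \<in> V"
    using Suc.prems unfolding eq by (auto simp: V_iff le_fun_def unit_index_def)
  have nV: "?n \<in> V" using V_summands[OF V] by simp
  have "reorder q (unit_index i) ?n = 1"
    by (rule reorder_eq_1) (auto simp: unit_index_def)
  moreover have "reorder q (\<pi> ?n) (\<pi> (unit_index i)) = 1"
    unfolding pi_eq_perm_act[OF nV] pi_unit
  proof (rule reorder_eq_1)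
    fix x y :: 'n assume "x < y"
    moreover have "\<sigma> (inv_into UNIV \<sigma> y) = y"
      using bij_sigma by (simp add: bij_is_surj surj_f_inv_f)
    ultimately show "perm_act \<sigma> ?n y = 0 \<or> unit_index (\<sigma> i) x = (0::nat)"
      by (cases "inv_into UNIV \<sigma> y = i") (auto simp: perm_act_def unit_index_def)
  qed
  ultimately show ?case
    using c_add[OF V] Suc unfolding eq by simp
qed

text \<open>
  The part of the top exponent supported on \<open>J\<close> is built up from the largest index downwards. Adding
  a new smallest index \<open>b\<close> costs nothing on the unpermuted side, because \<open>x\<^sub>b\<close> comes first in
  standard monomials, and contributes the factors for the pairs \<open>(b, k)\<close> on the permuted side,
  because \<open>S\<close> reverses the order.
\<close>

lemma c_restricted_top:
  fixes J :: "'n set"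
  shows "c (\<lambda>i. if i \<in> J then topv i else 0) = (\<Prod>i\<in>J. d i ^ topv i) *
    (\<Prod>(j, k)\<in>{(j, k). j \<in> J \<and> k \<in> J \<and> j < k}.
       reorder q (unit_index (\<sigma> k)) (unit_index (\<sigma> j)) ^ (topv k * topv j))"
  using finite[of J]
proof (induction J rule: finite_linorder_min_induct)
  case empty
  have "(\<lambda>i. if i \<in> {} then topv i else 0) = 0" by (simp add: fun_eq_iff)
  then show ?case by (simp add: c_zero)
next
  case (insert b J)
  let ?\<beta> = "\<lambda>j k. reorder q (unit_index (\<sigma> k)) (unit_index (\<sigma> j)) ^ (topv k * topv j)"
  let ?P = "\<lambda>J. {(j, k). j \<in> J \<and> k \<in> J \<and> j < k}"
  let ?u = "\<lambda>i. topv b * unit_index b i" and ?v = "\<lambda>i. if i \<in> J then topv i else 0"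
  have b: "b \<notin> J" using insert.hyps by blast
  have eq: "?u + ?v = (\<lambda>i. if i \<in> insert b J then topv i else 0)"
    using b by (auto simp: fun_eq_iff unit_index_def)
  have V: "?u + ?v \<in> V"
    unfolding eq by (simp add: V_iff le_fun_def)
  note uV = V_summands[OF V]
  \<comment> \<open>The index \<open>b\<close> is smaller than all of \<open>J\<close>, so the two blocks are already in order.\<close>
  have "reorder q ?u ?v = 1"
    using insert.hyps(2) by (intro reorder_eq_1) (auto simp: unit_index_def)
  moreover have "reorder q (\<pi> ?v) (\<pi> ?u) = (\<Prod>k\<in>J. ?\<beta> b k)"
  proof -
    have "reorder q (\<pi> ?v) (\<pi> ?u) = (\<Prod>j\<in>UNIV. \<Prod>k\<in>UNIV.
        reorder q (unit_index (\<sigma> k)) (unit_index (\<sigma> j)) ^ (?v k * ?u j))"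
      unfolding pi_eq_perm_act[OF uV(1)] pi_eq_perm_act[OF uV(2)]
      by (rule reorder_perm_act[OF bij_sigma])
    also have "\<dots> = (\<Prod>j\<in>UNIV. if j = b then \<Prod>k\<in>J. ?\<beta> b k else 1)"
    proof (rule prod.cong)
      fix j
      show "(\<Prod>k\<in>UNIV. reorder q (unit_index (\<sigma> k)) (unit_index (\<sigma> j)) ^ (?v k * ?u j)) =
          (if j = b then \<Prod>k\<in>J. ?\<beta> b k else 1)"
        by (auto simp: unit_index_def intro: prod.mono_neutral_cong_right)
    qed simp
    also have "\<dots> = (\<Prod>k\<in>J. ?\<beta> b k)" by simp
    finally show ?thesis .
  qed
  moreover have "c ?u = d b ^ topv b" by (rule c_multiple_unit) simp
  ultimately have "c (?u + ?v) = d b ^ topv b * c ?v * (\<Prod>k\<in>J. ?\<beta> b k)"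
    using c_add[OF V] by simp
  moreover have "?P (insert b J) = Pair b ` J \<union> ?P J"
    using insert.hyps(2) b by (auto dest: less_asym)
  moreover have "(\<Prod>(j, k)\<in>Pair b ` J \<union> ?P J. ?\<beta> j k) = (\<Prod>k\<in>J. ?\<beta> b k) * (\<Prod>(j, k)\<in>?P J. ?\<beta> j k)"
    using b by (subst prod.union_disjoint) (auto simp: prod.reindex inj_on_def)
  ultimately show ?case
    using b insert.IH by (simp add: eq mult_ac)
qed

lemma qperm_times_prod: "qperm q a \<sigma> * (\<Prod>i\<in>UNIV. d i ^ (a i - 1)) = 1"
proof -
  have qperm: "qperm q a \<sigma> = (\<Prod>(j, k)\<in>{(j, k). j < k}.
      reorder q (unit_index (\<sigma> k)) (unit_index (\<sigma> j)) ^ (topv k * topv j))"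
    unfolding qperm_def perm_act_unit[OF bij_sigma]
    by (simp add: top_index_def flip: of_nat_unit_index qpair_of_nat)
  have "coord topv (S (e topv)) = c topv"
    using S_monomial[OF top_V] by (simp add: pi_top coord_smult coord_monomial)
  then have "c topv = 1"
    by (simp add: S_top coord_monomial)
  then show ?thesis
    using c_restricted_top[of UNIV] by (simp add: qperm top_index_def mult.commute)
qed

end

section \<open>The structure of permutation antipodes\<close>

theorem theorem5p2:
  fixes q :: "'n::{finite,linorder} \<Rightarrow> 'n \<Rightarrow> 'k::field"
    and a :: "'n \<Rightarrow> nat"
    and \<Delta> :: "('n list \<Rightarrow>\<^sub>0 'k) set \<Rightarrow> (('n list \<Rightarrow>\<^sub>0 'k) set \<times> ('n list \<Rightarrow>\<^sub>0 'k) set) list"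
    and \<epsilon> \<phi> :: "('n list \<Rightarrow>\<^sub>0 'k) set \<Rightarrow> 'k"
    and t :: "('n list \<Rightarrow>\<^sub>0 'k) set"
    and S :: "('n list \<Rightarrow>\<^sub>0 'k) set \<Rightarrow> ('n list \<Rightarrow>\<^sub>0 'k) set"
    and \<pi> :: "('n \<Rightarrow> nat) \<Rightarrow> 'n \<Rightarrow> nat"
    and c :: "('n \<Rightarrow> nat) \<Rightarrow> 'k"
  assumes "qci_params q a"
    and "bi_frobenius (qci q a) \<Delta> \<epsilon> \<phi> t S"
    and "permutation_antipode q a S \<pi> c"
  shows "(S (qci_monomial q a (top_index a)) = qci_monomial q a (top_index a) \<and>
          \<pi> (top_index a) = top_index a \<and>
          \<pi> \<circ> \<pi> = id \<and>
          graded_map q a S \<and>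
          canonical_nakayama q a (S \<circ> S) \<and>
          (\<forall>y\<in>carrier (qci q a). S (S (S (S y))) = y)) \<and>
         (\<exists>\<sigma>. compatible_perm q a \<sigma> \<and>
          (\<forall>v\<in>basis_index a.
             \<pi> v = perm_act \<sigma> v \<and>
             qci_monomial q a (\<pi> v) = qci_monomial q a (\<lambda>i. v (inv_into UNIV \<sigma> i))) \<and>
          (\<exists>d. (\<forall>i. S (qci_gen q a i) = d i \<odot>\<^bsub>qci q a\<^esub> qci_gen q a (\<sigma> i)) \<and>
               (\<forall>i. d i * d (\<sigma> i) = hcoef q a (unit_index i)) \<and>
               qperm q a \<sigma> * (\<Prod>i\<in>UNIV. d i ^ (a i - 1)) = 1))"
proof -
  interpret permutation_antipode_qci q a \<Delta> \<epsilon> \<phi> t S \<pi> c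
    using assms by unfold_locales
  have "\<pi> (\<pi> v) = v" for v
    by (cases "v \<in> V") (simp_all add: pi_pi_V permutes_not_in[OF pi_permutes])
  then have "\<pi> \<circ> \<pi> = id" by (simp add: fun_eq_iff)
  moreover have "S (qci_gen q a i) = d i \<odot>\<^bsub>R\<^esub> qci_gen q a (\<sigma> i)" for i
    using S_monomial[OF unit_V, of i] by (simp add: pi_unit monomial_unit)
  moreover have "d i * d (\<sigma> i) = hcoef q a (unit_index i)" for i
    using c_mult_c[OF unit_V, of i] by (simp add: pi_unit of_nat_unit_index)
  ultimately show ?thesis
    using S_top pi_top graded_S S_S_nakayama S_fourth compatible_sigma qperm_times_prod
    by (intro conjI exI[of _ \<sigma>] exI[of _ "\<lambda>i. d i"] ballI allI)
       (simp_all add: pi_eq_perm_act, simp_all add: perm_act_def)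
qed

end
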